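(* Let $(G,\mu)$ be a countable measured group. If $A \subset G$ is $\mathcal{L}_\mu$-large, then the difference set $AA^{-1}=\{ab^{-1}: a,b\in A\}$ is right piecewise left syndetic. However, $AA^{-1}$ is not necessarily left syndetic: there exist a countable measured group $(G,\mu)$ and an $\mathcal{L}_\mu$-large set $A\subset G$ such that $AA^{-1}$ is not left syndetic.
   Context: A countable measured group $(G,\mu)$ is a countable group $G$ with a probability measure $\mu$ on $G$ such that $\mu(g)=\mu(g^{-1})$ for all $g$ and the support of $\mu$ generates $G$. A mean on $G$ is a positive linear functional of norm one on $\ell^\infty(G)$; $\mathcal{M}(G)$ is the set of all means. Let $(\rho(\mu)\varphi)(x)=\int_G \varphi(g^{-1}x)\,d\mu(g)$ for $\varphi\in\ell^\infty(G)$, and $\mathcal{L}_\mu=\{\lambda\in\mathcal{M}(G): \rho(\mu)^*\lambda=\lambda\}$. A set $A\subset G$ is $\mathcal{L}_\mu$-large if $\sup_{\lambda\in\mathcal{L}_\mu}\lambda(\chi_A)>0$. A set $T\subset G$ is right thick if for every finite $F\subset G$ there is $g\in G$ with $Fg\subset T$. A set $C\subset G$ is left syndetic if $FC=G$ for some finite $F\subset G$, and right piecewise left syndetic if there is a finite set $F\subset G$ such that $FC$ is right thick. *)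

theory Defs
  imports "HOL-Algebra.Generated_Groups" "HOL-Probability.Probability"
begin

text \<open>
  The carrier is countable, so a probability measure on all of its subsets is the same thing as a
  \<^typ>\<open>'a pmf\<close> supported in the carrier.
\<close>

locale countable_measured_group = group G for G (structure) +
  fixes \<mu> :: "'a pmf"
  assumes countable_carrier: "countable (carrier G)"
    and supp_subset: "set_pmf \<mu> \<subseteq> carrier G"
    and symmetric: "g \<in> carrier G \<Longrightarrow> pmf \<mu> g = pmf \<mu> (inv g)"
    and supp_generates: "generate G (set_pmf \<mu>) = carrier G"

text \<open>
  Functions on the group and functionals on \<open>linf G\<close> are represented extensionally, so that
  equality of HOL functions is equality on the carrier and on \<open>linf G\<close>, respectively.
\<close>

definition linf :: "('a, 'b) monoid_scheme \<Rightarrow> ('a \<Rightarrow> real) set" where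
  "linf G = {\<phi> \<in> extensional (carrier G). bounded (\<phi> ` carrier G)}"

definition linf_norm :: "('a, 'b) monoid_scheme \<Rightarrow> ('a \<Rightarrow> real) \<Rightarrow> real" where
  "linf_norm G \<phi> = (SUP x\<in>carrier G. \<bar>\<phi> x\<bar>)"

text \<open>The supremum is taken in the extended reals, so an unbounded functional has norm \<open>\<infinity>\<close>.\<close>

definition functional_norm :: "('a, 'b) monoid_scheme \<Rightarrow> (('a \<Rightarrow> real) \<Rightarrow> real) \<Rightarrow> ereal" where
  "functional_norm G m = (SUP \<phi>\<in>{\<phi> \<in> linf G. linf_norm G \<phi> \<le> 1}. ereal \<bar>m \<phi>\<bar>)"

definition linear_functional :: "('a, 'b) monoid_scheme \<Rightarrow> (('a \<Rightarrow> real) \<Rightarrow> real) \<Rightarrow> bool" where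
  "linear_functional G m \<longleftrightarrow>
     (\<forall>\<phi>\<in>linf G. \<forall>\<psi>\<in>linf G. m (\<lambda>x\<in>carrier G. \<phi> x + \<psi> x) = m \<phi> + m \<psi>) \<and>
     (\<forall>c. \<forall>\<phi>\<in>linf G. m (\<lambda>x\<in>carrier G. c * \<phi> x) = c * m \<phi>)"

definition positive_functional :: "('a, 'b) monoid_scheme \<Rightarrow> (('a \<Rightarrow> real) \<Rightarrow> real) \<Rightarrow> bool" where
  "positive_functional G m \<longleftrightarrow> (\<forall>\<phi>\<in>linf G. (\<forall>x\<in>carrier G. 0 \<le> \<phi> x) \<longrightarrow> 0 \<le> m \<phi>)"

definition means :: "('a, 'b) monoid_scheme \<Rightarrow> (('a \<Rightarrow> real) \<Rightarrow> real) set" where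
  "means G = {m \<in> extensional (linf G).
     linear_functional G m \<and> positive_functional G m \<and> functional_norm G m = 1}"

definition rho :: "('a, 'b) monoid_scheme \<Rightarrow> 'a pmf \<Rightarrow> ('a \<Rightarrow> real) \<Rightarrow> 'a \<Rightarrow> real" where
  "rho G \<mu> \<phi> = (\<lambda>x\<in>carrier G. measure_pmf.expectation \<mu> (\<lambda>g. \<phi> (inv\<^bsub>G\<^esub> g \<otimes>\<^bsub>G\<^esub> x)))"

definition rho_adjoint ::
    "('a, 'b) monoid_scheme \<Rightarrow> 'a pmf \<Rightarrow> (('a \<Rightarrow> real) \<Rightarrow> real) \<Rightarrow> ('a \<Rightarrow> real) \<Rightarrow> real" where
  "rho_adjoint G \<mu> m = (\<lambda>\<phi>\<in>linf G. m (rho G \<mu> \<phi>))"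

definition stationary_means ::
    "('a, 'b) monoid_scheme \<Rightarrow> 'a pmf \<Rightarrow> (('a \<Rightarrow> real) \<Rightarrow> real) set" where
  "stationary_means G \<mu> = {m \<in> means G. rho_adjoint G \<mu> m = m}"

definition stationary_large :: "('a, 'b) monoid_scheme \<Rightarrow> 'a pmf \<Rightarrow> 'a set \<Rightarrow> bool" where
  "stationary_large G \<mu> A \<longleftrightarrow>
     (SUP m\<in>stationary_means G \<mu>. ereal (m (restrict (indicator A) (carrier G)))) > 0"

text \<open>The following notions are meant for subsets of the carrier.\<close>

definition right_thick :: "('a, 'b) monoid_scheme \<Rightarrow> 'a set \<Rightarrow> bool" where
  "right_thick G T \<longleftrightarrow>
     (\<forall>F. finite F \<and> F \<subseteq> carrier G \<longrightarrow> (\<exists>g\<in>carrier G. F #>\<^bsub>G\<^esub> g \<subseteq> T))"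

definition left_syndetic :: "('a, 'b) monoid_scheme \<Rightarrow> 'a set \<Rightarrow> bool" where
  "left_syndetic G C \<longleftrightarrow> (\<exists>F. finite F \<and> F \<subseteq> carrier G \<and> F <#>\<^bsub>G\<^esub> C = carrier G)"

definition right_piecewise_left_syndetic :: "('a, 'b) monoid_scheme \<Rightarrow> 'a set \<Rightarrow> bool" where
  "right_piecewise_left_syndetic G C \<longleftrightarrow>
     (\<exists>F. finite F \<and> F \<subseteq> carrier G \<and> right_thick G (F <#>\<^bsub>G\<^esub> C))"

definition difference_set :: "('a, 'b) monoid_scheme \<Rightarrow> 'a set \<Rightarrow> 'a set" where
  "difference_set G A = {a \<otimes>\<^bsub>G\<^esub> inv\<^bsub>G\<^esub> b | a b. a \<in> A \<and> b \<in> A}"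

end

theory Submission
  imports Defs "HOL-Library.Sublist"
begin

text \<open>
  \<^emph>\<open>Large sets.\<close> For a stationary mean \<open>m\<close> the bounded function \<open>h x = m (x A)\<close> is \<open>\<mu>\<close>-harmonic.
  If \<open>h\<close> is close to its supremum \<open>s > 0\<close> at \<open>x\<close>, it is close to \<open>s\<close> on \<open>K x\<close> for any given
  finite \<open>K\<close>, so \<open>T = {h > s / 2}\<close> is right thick. A family of pairwise disjoint translates
  \<open>x A\<close> with \<open>x \<in> T\<close> has at most \<open>2 / s\<close> members; if \<open>F\<close> indexes one of maximal size, every
  other such translate meets \<open>F A\<close>, that is, \<open>T \<subseteq> F A A\<inverse>\<close>.

  \<^emph>\<open>The example.\<close> Let \<open>W\<^sub>k\<close> be the simple random walk on the free product of three groups of order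
  two, whose Cayley graph is the 3-regular tree. For every finite \<open>F\<close> there are a deep cone \<open>U\<close>
  and an element \<open>x\<close> much deeper inside \<open>U\<close> such that, uniformly in \<open>k\<close>, it is unlikely that
  \<open>x W\<^sub>k \<notin> U\<close> or that \<open>F W\<^sub>k\<close> meets \<open>U\<close>. Removing these exceptional events for an exhausting
  sequence of sets \<open>F\<close> leaves a set \<open>A\<close> with \<open>P (W\<^sub>k \<in> A) \<ge> 1 / 2\<close> for all \<open>k\<close>, which a Banach
  limit of the laws of \<open>W\<^sub>k\<close> sees. As \<open>x A \<subseteq> U\<close> and \<open>F A\<close> avoids \<open>U\<close>, the element \<open>x\<close> is
  not in \<open>F A A\<inverse>\<close>.
\<close>

text \<open>From here on \<open>x <# A\<close> is the left coset \<open>xA\<close>.\<close>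

no_notation subset_mset (infix "<#" 50)

section \<open>Difference sets of large sets\<close>

lemma in_linf_iff: "f \<in> linf G \<longleftrightarrow> f \<in> extensional (carrier G) \<and> (\<exists>B. \<forall>x\<in>carrier G. \<bar>f x\<bar> \<le> B)"
  by (auto simp: linf_def bounded_iff)

lemma restrict_in_linf:
  "(\<And>x. x \<in> carrier G \<Longrightarrow> \<bar>f x\<bar> \<le> B) \<Longrightarrow> restrict f (carrier G) \<in> linf G"
  by (auto simp: in_linf_iff)

lemma stationary_mean_rho:
  assumes "m \<in> stationary_means G \<mu>" and "\<phi> \<in> linf G"
  shows "m (rho G \<mu> \<phi>) = m \<phi>"
proof -
  have "m (rho G \<mu> \<phi>) = rho_adjoint G \<mu> m \<phi>" using assms(2) by (simp add: rho_adjoint_def)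
  also have "rho_adjoint G \<mu> m = m" using assms(1) by (simp add: stationary_means_def)
  finally show ?thesis .
qed

text \<open>A mean is only finitely additive, so it passes through finite sums but not directly
  through an expectation over an infinite support. Truncating to a finite \<open>S\<close> costs an
  arbitrarily small \<epsilon>, and keeping \<open>g0\<close> in \<open>S\<close> protects the one
  atom whose contribution matters.\<close>

lemma pmf_finite_approx:
  assumes "\<epsilon> > 0" and "g0 \<in> set_pmf p"
  obtains S where "finite S" "g0 \<in> S" "S \<subseteq> set_pmf p" "measure_pmf.prob p (- S) \<le> \<epsilon>"
proof -
  define S where "S = (\<lambda>n. from_nat_into (set_pmf p) ` {..n::nat})"
  have "incseq S"
    unfolding S_def incseq_def by (intro allI impI image_mono) auto
  moreover have U: "(\<Union>n. S n) = set_pmf p"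
  proof -
    have "(\<Union>n. S n) = range (from_nat_into (set_pmf p))" unfolding S_def by auto
    then show ?thesis using range_from_nat_into[of "set_pmf p"] by (simp add: set_pmf_not_empty countable_set_pmf)
  qed
  ultimately have "(\<lambda>n. measure_pmf.prob p (S n)) \<longlonglongrightarrow> measure_pmf.prob p (set_pmf p)"
    using measure_pmf.finite_Lim_measure_incseq[of S p] by simp
  then have "(\<lambda>n. measure_pmf.prob p (S n)) \<longlonglongrightarrow> 1"
    using measure_pmf.prob_eq_1[of "set_pmf p" p] by (simp add: AE_measure_pmf)
  then have "eventually (\<lambda>n. measure_pmf.prob p (S n) > 1 - \<epsilon>) sequentially"
    using assms(1) by (intro order_tendstoD) auto
  then obtain n where n: "measure_pmf.prob p (S n) > 1 - \<epsilon>"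
    by (auto simp: eventually_sequentially)
  have fin: "finite (S n)" by (simp add: S_def)
  show ?thesis
  proof (rule that[of "insert g0 (S n)"])
    show "insert g0 (S n) \<subseteq> set_pmf p" using assms(2) U by auto
    have "measure_pmf.prob p (- insert g0 (S n)) \<le> measure_pmf.prob p (- S n)"
      by (rule measure_pmf.finite_measure_mono) auto
    also have "\<dots> = 1 - measure_pmf.prob p (S n)"
      using measure_pmf.prob_compl[of "S n" p] by (simp add: Compl_eq_Diff_UNIV)
    finally show "measure_pmf.prob p (- insert g0 (S n)) \<le> \<epsilon>" using n by simp
  qed (use fin in auto)
qed

text \<open>The part outside \<open>S\<close> contributes at most its mass, since
  \<open>f \<le> 1\<close> on the support.\<close>

lemma expectation_le_finite_sum:
  fixes f :: "'a \<Rightarrow> real"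
  assumes "finite S" "\<And>x. x \<in> set_pmf p \<Longrightarrow> 0 \<le> f x \<and> f x \<le> 1"
    and S: "measure_pmf.prob p (- S) \<le> \<epsilon>"
  shows "measure_pmf.expectation p f \<le> (\<Sum>g\<in>S. pmf p g * f g) + \<epsilon>"
proof -
  have i: "integrable (measure_pmf p) (\<lambda>x. indicator S x * f x)"
    by (rule measure_pmf.integrable_const_bound[where B=1])
       (use assms(2) in \<open>auto simp: AE_measure_pmf_iff indicator_def\<close>)
  have "measure_pmf.expectation p f \<le> measure_pmf.expectation p (\<lambda>x. indicator S x * f x + indicator (- S) x)"
  proof (rule integral_mono_AE)
    show "integrable (measure_pmf p) f"
      by (rule measure_pmf.integrable_const_bound[where B=1])
       (use assms(2) in \<open>auto simp: AE_measure_pmf_iff\<close>)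
    show "integrable (measure_pmf p) (\<lambda>x. indicator S x * f x + indicator (- S) x)"
      using i by (intro Bochner_Integration.integrable_add) (auto simp: measure_pmf.emeasure_eq_measure)
  qed (use assms(2) in \<open>auto simp: AE_measure_pmf_iff indicator_def\<close>)
  also have "\<dots> = measure_pmf.expectation p (\<lambda>x. indicator S x * f x) + measure_pmf.prob p (- S)"
    using i by (subst Bochner_Integration.integral_add) (auto simp: measure_pmf.emeasure_eq_measure)
  also have "measure_pmf.expectation p (\<lambda>x. indicator S x * f x) = (\<Sum>g\<in>S. pmf p g * f g)"
    by (subst integral_measure_pmf_real[OF \<open>finite S\<close>]) (auto simp: indicator_def mult.commute intro!: sum.cong)
  finally show ?thesis using S by simp
qed

section \<open>Arithmetic of a mean\<close>

context
  fixes G :: "('a, 'b) monoid_scheme" and m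
  assumes m: "m \<in> means G"
begin


text \<open>Elements of \<open>linf G\<close> are extensional; restricting first lets
  \<open>m\<close> act on ordinary pointwise expressions such as sums of indicators.\<close>

definition mean_of :: "('a \<Rightarrow> real) \<Rightarrow> real" where
  "mean_of f = m (restrict f (carrier G))"

lemma mean_of_add:
  assumes "\<And>x. x \<in> carrier G \<Longrightarrow> \<bar>f x\<bar> \<le> B" "\<And>x. x \<in> carrier G \<Longrightarrow> \<bar>g x\<bar> \<le> C"
  shows "mean_of (\<lambda>x. f x + g x) = mean_of f + mean_of g"
proof -
  have eq: "(\<lambda>x\<in>carrier G. restrict f (carrier G) x + restrict g (carrier G) x) = (\<lambda>x\<in>carrier G. f x + g x)"
    by (intro restrict_ext) simp
  have "m (\<lambda>x\<in>carrier G. restrict f (carrier G) x + restrict g (carrier G) x)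
      = m (restrict f (carrier G)) + m (restrict g (carrier G))"
    using m restrict_in_linf[of G f B] restrict_in_linf[of G g C] assms
    unfolding means_def linear_functional_def by blast
  then show ?thesis unfolding eq mean_of_def .
qed

lemma mean_of_cmult:
  assumes "\<And>x. x \<in> carrier G \<Longrightarrow> \<bar>f x\<bar> \<le> B"
  shows "mean_of (\<lambda>x. c * f x) = c * mean_of f"
proof -
  have eq: "(\<lambda>x\<in>carrier G. c * restrict f (carrier G) x) = (\<lambda>x\<in>carrier G. c * f x)"
    by (intro restrict_ext) simp
  have "m (\<lambda>x\<in>carrier G. c * restrict f (carrier G) x) = c * m (restrict f (carrier G))"
    using m restrict_in_linf[of G f B] assms
    unfolding means_def linear_functional_def by blast
  then show ?thesis unfolding eq mean_of_def .
qed

lemma mean_of_sum: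
  assumes "finite I" "\<And>i x. i \<in> I \<Longrightarrow> x \<in> carrier G \<Longrightarrow> \<bar>f i x\<bar> \<le> B"
  shows "mean_of (\<lambda>x. \<Sum>i\<in>I. f i x) = (\<Sum>i\<in>I. mean_of (f i))"
  using assms
proof (induction I rule: finite_induct)
  case empty
  show ?case using mean_of_cmult[of "\<lambda>_. 0" 0 0] by simp
next
  case (insert i I)
  have "\<bar>\<Sum>i\<in>I. f i x\<bar> \<le> card I * B" if "x \<in> carrier G" for x
    using sum_bounded_above[of I "\<lambda>i. \<bar>f i x\<bar>" B] insert.prems that
    by (intro order.trans[OF sum_abs]) auto
  then show ?case
    using insert mean_of_add[of "f i" B "\<lambda>x. \<Sum>i\<in>I. f i x" "card I * B"] by simp
qed

lemma mean_of_mono: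
  assumes "\<And>x. x \<in> carrier G \<Longrightarrow> \<bar>f x\<bar> \<le> B" "\<And>x. x \<in> carrier G \<Longrightarrow> \<bar>g x\<bar> \<le> C"
    and "\<And>x. x \<in> carrier G \<Longrightarrow> f x \<le> g x"
  shows "mean_of f \<le> mean_of g"
proof -
  have b: "\<bar>- 1 * f x\<bar> \<le> B" if "x \<in> carrier G" for x using assms(1) that by auto
  have 1: "mean_of (\<lambda>x. g x + - 1 * f x) = mean_of g + mean_of (\<lambda>x. - 1 * f x)"
    by (rule mean_of_add[OF assms(2) b])
  have 2: "mean_of (\<lambda>x. - 1 * f x) = - 1 * mean_of f" by (rule mean_of_cmult[OF assms(1)])
  have 3: "0 \<le> mean_of (\<lambda>x. g x + - 1 * f x)"
  proof -
    have "restrict (\<lambda>x. g x + - 1 * f x) (carrier G) \<in> linf G"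
      using assms(1,2) by (intro restrict_in_linf[of G _ "B + C"]) fastforce
    moreover have "0 \<le> restrict (\<lambda>x. g x + - 1 * f x) (carrier G) x" if "x \<in> carrier G" for x
      using that assms(3) by simp
    ultimately show ?thesis
      using m unfolding means_def positive_functional_def mean_of_def by blast
  qed
  show ?thesis using 3 unfolding 1 2 by simp
qed

text \<open>The constant 1 has norm at most 1, so norm one of \<open>m\<close> bounds its mean by 1;
  the rest is scaling.\<close>

lemma mean_of_const_le:
  assumes "carrier G \<noteq> {}" and c: "0 \<le> c"
  shows "mean_of (\<lambda>_. c) \<le> c"
proof -
  let ?o = "restrict (\<lambda>_. 1) (carrier G) :: 'a \<Rightarrow> real"
  have "linf_norm G ?o \<le> 1"
    unfolding linf_norm_def using assms(1) by (intro cSUP_least) auto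
  then have "ereal \<bar>m ?o\<bar> \<le> functional_norm G m"
    unfolding functional_norm_def
    by (intro SUP_upper CollectI conjI restrict_in_linf[where B = 1]) (simp, assumption)
  also have "functional_norm G m = 1" using m by (simp add: means_def)
  finally have "mean_of (\<lambda>_. 1) \<le> 1" unfolding mean_of_def by simp
  then have "c * mean_of (\<lambda>_. 1) \<le> c * 1" using c by (rule mult_left_mono)
  then show ?thesis using mean_of_cmult[of "\<lambda>_. 1" 1 c] by simp
qed

end

section \<open>Translates of a set under a stationary mean\<close>

context countable_measured_group
begin

text \<open>This turns \<open>rho\<close> applied to the indicator of \<open>xA\<close> into the
  \<mu>-average of the indicators of the translates \<open>gxA\<close>.\<close>

lemma inv_mult_mem_l_coset_iff:
  assumes "g \<in> carrier G" "x \<in> carrier G" "y \<in> carrier G" "A \<subseteq> carrier G"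
  shows "inv g \<otimes> y \<in> x <# A \<longleftrightarrow> y \<in> (g \<otimes> x) <# A"
proof -
  have "inv g \<otimes> y = x \<otimes> a \<longleftrightarrow> y = g \<otimes> x \<otimes> a" if "a \<in> carrier G" for a
    using assms that by (metis inv_solve_left m_assoc m_closed)
  then show ?thesis using assms(4) by (auto simp: l_coset_def subset_iff)
qed

text \<open>With \<open>h y = m (yA)\<close>, stationarity makes \<open>h x\<close> the
  \<mu>-average of the values \<open>h (g x)\<close>. Bounding all of these by \<open>s\<close>
  except the one at \<open>g0\<close> gives the claim after rearranging.\<close>

lemma stationary_mean_translate_le:
  assumes m: "m \<in> stationary_means G \<mu>" and A: "A \<subseteq> carrier G"
    and s: "\<And>y. y \<in> carrier G \<Longrightarrow> mean_of G m (indicator (y <# A)) \<le> s"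
    and x: "x \<in> carrier G" and g0: "g0 \<in> set_pmf \<mu>"
  shows "pmf \<mu> g0 * (s - mean_of G m (indicator ((g0 \<otimes> x) <# A))) \<le> s - mean_of G m (indicator (x <# A))"
proof -
  define h where "h = (\<lambda>y. mean_of G m (indicator (y <# A)))"
  have mm: "m \<in> means G" using m by (simp add: stationary_means_def)
  have "0 \<le> h x"
    using mean_of_mono[OF mm, of "\<lambda>_. 0" 0 "indicator (x <# A)" 1] mean_of_cmult[OF mm, of "\<lambda>_. 0" 0 0]
    by (simp add: h_def)
  \<comment> \<open>Nonnegativity of \<open>s\<close> allows the mass of \<open>S - {g0}\<close> to
    be enlarged to \<open>1 - pmf \<mu> g0\<close> below.\<close>
  then have s0: "0 \<le> s" using s[OF x] by (simp add: h_def)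
  have "h x \<le> pmf \<mu> g0 * h (g0 \<otimes> x) + (1 - pmf \<mu> g0) * s + \<epsilon>" if \<epsilon>: "\<epsilon> > 0" for \<epsilon>
  proof -
    obtain S where S: "finite S" "g0 \<in> S" "S \<subseteq> set_pmf \<mu>" "measure_pmf.prob \<mu> (- S) \<le> \<epsilon>"
      using pmf_finite_approx[OF \<epsilon> g0] by blast
    have Sc: "g \<in> carrier G" if "g \<in> S" for g using S(3) supp_subset that by blast
    let ?\<phi> = "restrict (indicator (x <# A)) (carrier G) :: 'a \<Rightarrow> real"
    let ?I = "\<lambda>g y. indicator ((g \<otimes> x) <# A) y :: real"
    have bnd: "0 \<le> (\<Sum>g\<in>S. pmf \<mu> g * ?I g y)" "(\<Sum>g\<in>S. pmf \<mu> g * ?I g y) \<le> card S" for y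
      using sum_bounded_above[of S "\<lambda>g. pmf \<mu> g * ?I g y" 1]
      by (auto intro!: sum_nonneg simp: indicator_def pmf_le_1)
    have "?\<phi> \<in> linf G" by (rule restrict_in_linf[where B = 1]) simp
    have "h x = m ?\<phi>" by (simp only: h_def mean_of_def[OF mm])
    also have "\<dots> = m (rho G \<mu> ?\<phi>)"
      using stationary_mean_rho[OF m \<open>?\<phi> \<in> linf G\<close>] by simp
    also have "rho G \<mu> ?\<phi> = (\<lambda>y\<in>carrier G. measure_pmf.expectation \<mu> (\<lambda>g. ?I g y))"
      unfolding rho_def
    proof (intro restrict_ext integral_cong_AE)
      fix y assume y: "y \<in> carrier G"
      show "AE g in \<mu>. ?\<phi> (inv g \<otimes> y) = ?I g y"
        unfolding AE_measure_pmf_iff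
      proof
        fix g assume "g \<in> set_pmf \<mu>"
        then have "g \<in> carrier G" using supp_subset by blast
        then show "?\<phi> (inv g \<otimes> y) = ?I g y"
          using y x A inv_mult_mem_l_coset_iff[of g x y A] by (simp add: indicator_def)
      qed
    qed auto
    also have "m \<dots> = mean_of G m (\<lambda>y. measure_pmf.expectation \<mu> (\<lambda>g. ?I g y))"
      by (simp add: mean_of_def[OF mm])
    also have "\<dots> \<le> mean_of G m (\<lambda>y. (\<Sum>g\<in>S. pmf \<mu> g * ?I g y) + \<epsilon>)"
    proof (rule mean_of_mono[OF mm, where B = 1 and C = "card S + \<epsilon>"])
      fix y
      have "0 \<le> measure_pmf.expectation \<mu> (\<lambda>g. ?I g y)"
        by (rule Bochner_Integration.integral_nonneg) simp
      moreover have "measure_pmf.expectation \<mu> (\<lambda>g. ?I g y) \<le> 1"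
        by (intro measure_pmf.integral_le_const measure_pmf.integrable_const_bound[where B=1]) auto
      ultimately show "\<bar>measure_pmf.expectation \<mu> (\<lambda>g. ?I g y)\<bar> \<le> 1" by simp
      show "\<bar>(\<Sum>g\<in>S. pmf \<mu> g * ?I g y) + \<epsilon>\<bar> \<le> card S + \<epsilon>" using \<epsilon> bnd[of y] by simp
      show "measure_pmf.expectation \<mu> (\<lambda>g. ?I g y) \<le> (\<Sum>g\<in>S. pmf \<mu> g * ?I g y) + \<epsilon>"
        using S by (intro expectation_le_finite_sum) auto
    qed
    also have "\<dots> = mean_of G m (\<lambda>y. \<Sum>g\<in>S. pmf \<mu> g * ?I g y) + mean_of G m (\<lambda>_. \<epsilon>)"
    proof (rule mean_of_add[OF mm, where B = "card S" and C = \<epsilon>])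
      fix y
      show "\<bar>\<Sum>g\<in>S. pmf \<mu> g * ?I g y\<bar> \<le> card S" using bnd[of y] by simp
    qed (use \<epsilon> in simp)
    also have "mean_of G m (\<lambda>y. \<Sum>g\<in>S. pmf \<mu> g * ?I g y) = (\<Sum>g\<in>S. mean_of G m (\<lambda>y. pmf \<mu> g * ?I g y))"
      by (rule mean_of_sum[OF mm S(1), where B = 1]) (simp add: indicator_def pmf_le_1)
    also have "\<dots> = (\<Sum>g\<in>S. pmf \<mu> g * h (g \<otimes> x))"
      unfolding h_def by (intro sum.cong refl mean_of_cmult[OF mm, where B = 1]) simp
    also have "\<dots> = pmf \<mu> g0 * h (g0 \<otimes> x) + (\<Sum>g\<in>S - {g0}. pmf \<mu> g * h (g \<otimes> x))"
      by (rule sum.remove[OF S(1,2)])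
    also have "(\<Sum>g\<in>S - {g0}. pmf \<mu> g * h (g \<otimes> x)) \<le> (\<Sum>g\<in>S - {g0}. pmf \<mu> g * s)"
      using s x Sc unfolding h_def by (intro sum_mono mult_left_mono) auto
    also have "\<dots> = (\<Sum>g\<in>S - {g0}. pmf \<mu> g) * s" by (simp add: sum_distrib_right)
    also have "\<dots> \<le> (1 - pmf \<mu> g0) * s"
    proof (rule mult_right_mono[OF _ s0])
      have "(\<Sum>g\<in>S. pmf \<mu> g) \<le> 1"
        using S(1) by (simp add: measure_measure_pmf_finite[symmetric])
      then show "(\<Sum>g\<in>S - {g0}. pmf \<mu> g) \<le> 1 - pmf \<mu> g0"
        using sum.remove[OF S(1,2), of "pmf \<mu>"] by simp
    qed
    also have "mean_of G m (\<lambda>_. \<epsilon>) \<le> \<epsilon>"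
      using \<epsilon> x by (intro mean_of_const_le[OF mm]) auto
    finally show ?thesis by simp
  qed
  then have "h x \<le> pmf \<mu> g0 * h (g0 \<otimes> x) + (1 - pmf \<mu> g0) * s"
    by (rule field_le_epsilon)
  then show ?thesis by (simp add: h_def algebra_simps)
qed

lemma set_pmf_inv: "g \<in> set_pmf \<mu> \<Longrightarrow> inv g \<in> set_pmf \<mu>"
  using symmetric[of g] supp_subset by (auto simp: set_pmf_iff)

text \<open>Harnack's inequality for the nonnegative \<open>\<mu>\<close>-harmonic function \<open>x \<mapsto> s - m (x A)\<close>.\<close>

lemma stationary_mean_harnack:
  assumes m: "m \<in> stationary_means G \<mu>" and A: "A \<subseteq> carrier G"
    and s: "\<And>y. y \<in> carrier G \<Longrightarrow> mean_of G m (indicator (y <# A)) \<le> s"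
    and y: "y \<in> carrier G"
  shows "\<exists>c>0. \<forall>x\<in>carrier G.
    s - mean_of G m (indicator ((y \<otimes> x) <# A)) \<le> c * (s - mean_of G m (indicator (x <# A)))"
proof -
  define h where "h = (\<lambda>y. mean_of G m (indicator (y <# A)))"
  have step: "\<exists>c>0. \<forall>x\<in>carrier G. s - h (g \<otimes> x) \<le> c * (s - h x)" if "g \<in> set_pmf \<mu>" for g
  proof (intro exI[of _ "1 / pmf \<mu> g"] conjI ballI)
    have pos: "0 < pmf \<mu> g" using that by (simp add: set_pmf_iff pmf_pos)
    then show "0 < 1 / pmf \<mu> g" by simp
    fix x assume "x \<in> carrier G"
    from stationary_mean_translate_le[OF m A s this that]
    show "s - h (g \<otimes> x) \<le> 1 / pmf \<mu> g * (s - h x)"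
      using pos by (simp add: h_def field_simps)
  qed
  \<comment> \<open>The constants \<open>1 / pmf \<mu> g\<close> of the generators multiply along
    words; symmetry of \<mu> takes care of inverse generators.\<close>
  have "y \<in> generate G (set_pmf \<mu>)" using y by (simp add: supp_generates)
  then have "\<exists>c>0. \<forall>x\<in>carrier G. s - h (y \<otimes> x) \<le> c * (s - h x)"
  proof induction
    case one
    show ?case by (intro exI[of _ 1]) simp
  next
    case (incl g)
    then show ?case by (rule step)
  next
    case (inv g)
    then show ?case by (intro step set_pmf_inv)
  next
    case (eng a b)
    then obtain c d where c: "c > 0" "\<And>x. x \<in> carrier G \<Longrightarrow> s - h (a \<otimes> x) \<le> c * (s - h x)"
      and d: "d > 0" "\<And>x. x \<in> carrier G \<Longrightarrow> s - h (b \<otimes> x) \<le> d * (s - h x)" by blast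
    have ab: "a \<in> carrier G" "b \<in> carrier G" using eng supp_generates by auto
    show ?case
    proof (intro exI[of _ "c * d"] conjI ballI)
      fix x assume x: "x \<in> carrier G"
      have "s - h (a \<otimes> (b \<otimes> x)) \<le> c * (s - h (b \<otimes> x))" using ab x by (intro c) auto
      also have "\<dots> \<le> c * (d * (s - h x))" using c(1) d(2)[OF x] by (intro mult_left_mono) auto
      finally show "s - h (a \<otimes> b \<otimes> x) \<le> c * d * (s - h x)" using ab x by (simp add: m_assoc mult.assoc)
    qed (use c d in simp)
  qed
  then show ?thesis unfolding h_def .
qed

theorem stationary_large_difference_set:
  assumes A: "A \<subseteq> carrier G" and large: "stationary_large G \<mu> A"
  shows "right_piecewise_left_syndetic G (difference_set G A)"
proof -
  obtain m where m: "m \<in> stationary_means G \<mu>" and pos: "m (restrict (indicator A) (carrier G)) > 0"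
    using large unfolding stationary_large_def less_SUP_iff by auto
  have mm: "m \<in> means G" using m by (simp add: stationary_means_def)
  define h where "h = (\<lambda>y. mean_of G m (indicator (y <# A)))"
  define s where "s = (SUP y\<in>carrier G. h y)"
  have h1: "h y \<le> 1" if "y \<in> carrier G" for y
  proof -
    have "h y \<le> mean_of G m (\<lambda>_. 1)"
      unfolding h_def by (rule mean_of_mono[OF mm, where B = 1 and C = 1]) (auto simp: indicator_def)
    also have "\<dots> \<le> 1" using that by (intro mean_of_const_le[OF mm]) auto
    finally show ?thesis .
  qed
  then have bdd: "bdd_above (h ` carrier G)" by (intro bdd_aboveI2[where M = 1]) auto
  have hs: "h y \<le> s" if "y \<in> carrier G" for y
    unfolding s_def using bdd that by (intro cSUP_upper)
  \<comment> \<open>The supremum \<open>s\<close> is positive because the translate by the identity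
    already has positive mean.\<close>
  have "\<one> <# A = A" using A lcos_mult_one by blast
  then have "0 < h \<one>" using pos by (simp add: h_def mean_of_def[OF mm])
  then have s0: "0 < s" using hs[of \<one>] by simp

  define T where "T = {y \<in> carrier G. h y > s / 2}"
  have thick: "\<exists>g\<in>carrier G. F #> g \<subseteq> T" if F: "finite F" "F \<subseteq> carrier G" for F
  proof -
    have "\<forall>y\<in>F. \<exists>c>0. \<forall>x\<in>carrier G. s - h (y \<otimes> x) \<le> c * (s - h x)"
    proof
      fix y assume "y \<in> F"
      then have "y \<in> carrier G" using F by blast
      from stationary_mean_harnack[OF m A hs[unfolded h_def] this]
      show "\<exists>c>0. \<forall>x\<in>carrier G. s - h (y \<otimes> x) \<le> c * (s - h x)" unfolding h_def .
    qed
    then obtain c where c: "\<And>y. y \<in> F \<Longrightarrow> c y > 0"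
      "\<And>y x. y \<in> F \<Longrightarrow> x \<in> carrier G \<Longrightarrow> s - h (y \<otimes> x) \<le> c y * (s - h x)" by metis
    \<comment> \<open>A single constant strictly above every \<open>c y\<close>; the summand 1 keeps
      it positive when \<open>F\<close> is empty.\<close>
    define C where "C = 1 + sum c F"
    have "0 \<le> sum c F" using c(1) by (intro sum_nonneg) (auto intro: less_imp_le)
    then have C: "0 < C" "\<And>y. y \<in> F \<Longrightarrow> c y < C"
      using member_le_sum[of _ F c] c(1) F(1) unfolding C_def by (force intro: less_imp_le)+
    \<comment> \<open>A defect below \<open>s / (2 * C)\<close> at \<open>x\<close> grows by a
      factor of at most \<open>C\<close> on \<open>F x\<close>, hence stays below
      \<open>s / 2\<close> there.\<close>
    have "\<exists>x\<in>carrier G. s - s / (2 * C) < h x"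
      using less_cSUP_iff[OF _ bdd, of "s - s / (2 * C)"] s0 C(1) by (fastforce simp: s_def[symmetric])
    then obtain x where x: "x \<in> carrier G" "s - s / (2 * C) < h x" by blast
    have "h (y \<otimes> x) > s / 2" if "y \<in> F" for y
    proof -
      have "s - h (y \<otimes> x) \<le> c y * (s - h x)" using c(2)[OF that x(1)] .
      also have "\<dots> \<le> C * (s - h x)" using C(2)[OF that] hs[OF x(1)] by (intro mult_right_mono) auto
      also have "\<dots> < C * (s / (2 * C))" using x(2) C(1) by (intro mult_strict_left_mono) auto
      finally show ?thesis using C(1) by simp
    qed
    then have "F #> x \<subseteq> T" using F x(1) by (auto simp: T_def r_coset_def)
    then show ?thesis using x(1) by blast
  qed

  define P where "P = (\<lambda>F. finite F \<and> F \<subseteq> T \<and> disjoint_family_on (\<lambda>x. x <# A) F)"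
  have card_le: "real (card F) \<le> 2 / s" if "P F" for F
  proof -
    have F: "finite F" "F \<subseteq> T" "disjoint_family_on (\<lambda>x. x <# A) F" using that by (auto simp: P_def)
    \<comment> \<open>Each translate has mean above \<open>s / 2\<close>, and by disjointness the
      indicators add up to an indicator, whose mean is at most 1.\<close>
    have "card F * (s / 2) \<le> (\<Sum>x\<in>F. h x)"
      using F(2) by (intro sum_bounded_below) (auto simp: T_def)
    also have "\<dots> = mean_of G m (\<lambda>y. \<Sum>x\<in>F. indicator (x <# A) y)"
      unfolding h_def using F(1) by (intro mean_of_sum[OF mm, symmetric, where B = 1]) (auto simp: indicator_def)
    also have "\<dots> = mean_of G m (indicator (\<Union>x\<in>F. x <# A))"
      using F(1,3) by (simp add: indicator_UN_disjoint[symmetric] fun_eq_iff disjoint_family_on_def)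
    also have "\<dots> \<le> mean_of G m (\<lambda>_. 1)"
      by (rule mean_of_mono[OF mm, where B = 1 and C = 1]) (auto simp: indicator_def)
    also have "\<dots> \<le> 1" by (intro mean_of_const_le[OF mm]) auto
    finally show ?thesis using s0 by (simp add: field_simps)
  qed
  have "\<exists>F. P F \<and> (\<forall>F'. P F' \<longrightarrow> card F' \<le> card F)"
  \<comment> \<open>The empty family starts the maximisation; \<open>Suc\<close> turns the bound
    \<open>2 / s\<close> on cardinalities into a strict integer bound.\<close>
  proof (rule ex_has_greatest_nat[where P = P and f = card and k = "{}" and b = "Suc (nat \<lfloor>2 / s\<rfloor>)"])
    show "P {}" by (simp add: P_def disjoint_family_on_def)
    show "\<forall>F. P F \<longrightarrow> card F < Suc (nat \<lfloor>2 / s\<rfloor>)" using card_le by (auto simp: less_Suc_eq_le intro!: le_nat_floor)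
  qed
  then obtain F where F: "P F" and max: "\<And>F'. P F' \<Longrightarrow> card F' \<le> card F" by blast
  have Fc: "finite F" "F \<subseteq> carrier G" using F by (auto simp: P_def T_def)
  have sub: "T \<subseteq> F <#> difference_set G A"
  proof
    fix x assume x: "x \<in> T"
    then have xc: "x \<in> carrier G" by (simp add: T_def)
    have "\<exists>f\<in>F. (f <# A) \<inter> (x <# A) \<noteq> {}"
    proof (cases "x \<in> F")
      case True
      \<comment> \<open>A translate indexed by \<open>F\<close> itself meets the family trivially,
        provided that \<open>A\<close> is nonempty; this follows from
        \<open>0 < h \<one>\<close>.\<close>
      have "A \<noteq> {}"
      proof
        assume "A = {}"
        moreover have "indicator {} = (\<lambda>_ :: 'a. 0 :: real)" by auto
        ultimately have "h \<one> = 0"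
          using mean_of_cmult[OF mm, of "\<lambda>_. 0" 0 0] by (simp add: h_def l_coset_def)
        then show False using \<open>0 < h \<one>\<close> by simp
      qed
      then show ?thesis using True by (auto simp: l_coset_def)
    next
      case False
      show ?thesis
      proof (rule ccontr)
        assume "\<not> ?thesis"
        then have "P (insert x F)" using F x by (auto simp: P_def disjoint_family_on_def)
        from max[OF this] show False using False Fc(1) by simp
      qed
    qed
    then obtain f a b where f: "f \<in> F" and ab: "a \<in> A" "b \<in> A" and eq: "f \<otimes> a = x \<otimes> b"
      by (auto simp: l_coset_def)
    have car: "f \<in> carrier G" "a \<in> carrier G" "b \<in> carrier G" using f ab Fc A by auto
    have "x = f \<otimes> (a \<otimes> inv b)"
      using eq car xc by (metis inv_closed inv_solve_right m_assoc m_closed)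
    then show "x \<in> F <#> difference_set G A"
      using f ab by (auto simp: set_mult_def difference_set_def)
  qed
  show ?thesis
    unfolding right_piecewise_left_syndetic_def right_thick_def
    using Fc thick sub by (meson subset_trans)
qed

end

section \<open>The random walk and stationary means\<close>

lemma integral_bind_pmf_bounded:
  fixes f :: "'a \<Rightarrow> real"
  assumes "\<And>x. \<bar>f x\<bar> \<le> B"
  shows "measure_pmf.expectation (bind_pmf p q) f = measure_pmf.expectation p (\<lambda>x. measure_pmf.expectation (q x) f)"
  unfolding measure_pmf_bind
  by (rule integral_bind[where B = B and B' = 1 and K = "count_space UNIV"])
     (use assms in \<open>auto simp: measure_pmf.emeasure_space_1[unfolded space_measure_pmf] measure_pmf_in_subprob_algebra\<close>)

context countable_measured_group
begin

text \<open>The steps \<open>inv g\<close> on the left are those of \<open>rho\<close>: averaging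
  \<open>rho G \<mu> \<phi>\<close> over one law is averaging \<phi> over the next.\<close>

primrec walk :: "nat \<Rightarrow> 'a pmf" where
  "walk 0 = return_pmf \<one>"
| "walk (Suc k) = bind_pmf (walk k) (\<lambda>x. map_pmf (\<lambda>g. inv g \<otimes> x) \<mu>)"

lemma mem_supp_carrier: "g \<in> set_pmf \<mu> \<Longrightarrow> g \<in> carrier G"
  using supp_subset by blast

lemma set_walk: "x \<in> set_pmf (walk k) \<Longrightarrow> x \<in> carrier G"
  by (induction k arbitrary: x) (auto dest: mem_supp_carrier)

lemma map_pmf_inv: "map_pmf (\<lambda>g. inv g) \<mu> = \<mu>"
proof (rule pmf_eqI)
  fix y
  have inj: "inj_on (\<lambda>g. inv g) (set_pmf \<mu>)"
    using inv_inj supp_subset by (rule inj_on_subset)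
  show "pmf (map_pmf (\<lambda>g. inv g) \<mu>) y = pmf \<mu> y"
  proof (cases "y \<in> set_pmf \<mu>")
    case True
    then have "pmf (map_pmf (\<lambda>g. inv g) \<mu>) (inv (inv y)) = pmf \<mu> (inv y)"
      by (intro pmf_map_inj inj set_pmf_inv)
    then show ?thesis using True symmetric[of y] by (simp add: mem_supp_carrier)
  next
    case False
    have "y \<notin> (\<lambda>g. inv g) ` set_pmf \<mu>"
      using False set_pmf_inv by blast
    then have "y \<notin> set_pmf (map_pmf (\<lambda>g. inv g) \<mu>)" by simp
    then show ?thesis using False unfolding pmf_eq_0_set_pmf[symmetric] by simp
  qed
qed

lemma walk_Suc_left: "walk (Suc k) = bind_pmf (walk k) (\<lambda>x. map_pmf (\<lambda>g. g \<otimes> x) \<mu>)"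
proof -
  have "map_pmf (\<lambda>g. inv g \<otimes> x) \<mu> = map_pmf (\<lambda>g. g \<otimes> x) \<mu>" for x
  proof -
    have "map_pmf (\<lambda>g. inv g \<otimes> x) \<mu> = map_pmf (\<lambda>g. g \<otimes> x) (map_pmf (\<lambda>g. inv g) \<mu>)"
      by (simp add: pmf.map_comp comp_def)
    then show ?thesis by (simp add: map_pmf_inv)
  qed
  then show ?thesis by simp
qed

text \<open>A walk with steps on the left has the same laws as one with steps on the right. The mean needs
  the former to be stationary; the hitting estimates on the Cayley graph need the latter, which
  commutes with left translations.\<close>

lemma walk_Suc_right: "walk (Suc k) = bind_pmf (walk k) (\<lambda>x. map_pmf (\<lambda>g. x \<otimes> g) \<mu>)"
proof (induction k)
  case 0
  have "map_pmf (\<lambda>g. g \<otimes> \<one>) \<mu> = map_pmf (\<lambda>g. \<one> \<otimes> g) \<mu>"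
    by (intro map_pmf_cong refl) (simp add: mem_supp_carrier)
  then show ?case by (simp only: walk_Suc_left) (simp add: bind_return_pmf)
next
  case (Suc k)
  let ?R = return_pmf
  have "walk (Suc (Suc k)) = bind_pmf (bind_pmf (walk k) (\<lambda>x. bind_pmf \<mu> (\<lambda>h. ?R (x \<otimes> h))))
      (\<lambda>y. bind_pmf \<mu> (\<lambda>g. ?R (g \<otimes> y)))"
    unfolding walk_Suc_left[of "Suc k"] Suc by (simp add: map_pmf_def)
  also have "\<dots> = bind_pmf (walk k) (\<lambda>x. bind_pmf \<mu> (\<lambda>h. bind_pmf \<mu> (\<lambda>g. ?R (g \<otimes> (x \<otimes> h)))))"
    by (simp add: bind_assoc_pmf bind_return_pmf)
  \<comment> \<open>The left step and the right step are drawn independently, and by associativity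
    either may be applied first.\<close>
  also have "\<dots> = bind_pmf (walk k) (\<lambda>x. bind_pmf \<mu> (\<lambda>g. bind_pmf \<mu> (\<lambda>h. ?R (g \<otimes> (x \<otimes> h)))))"
    by (subst bind_commute_pmf) (rule refl)
  also have "\<dots> = bind_pmf (walk k) (\<lambda>x. bind_pmf \<mu> (\<lambda>g. bind_pmf \<mu> (\<lambda>h. ?R (g \<otimes> x \<otimes> h))))"
    by (intro bind_pmf_cong refl) (simp add: m_assoc set_walk mem_supp_carrier)
  also have "\<dots> = bind_pmf (walk (Suc k)) (\<lambda>x. bind_pmf \<mu> (\<lambda>h. ?R (x \<otimes> h)))"
    unfolding walk_Suc_left[of k] by (simp add: map_pmf_def bind_assoc_pmf bind_return_pmf)
  finally show ?case by (simp add: map_pmf_def)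
qed

section \<open>Superharmonic bounds on the walk\<close>

lemma walk_superharmonic:
  fixes u :: "'a \<Rightarrow> ennreal"
  assumes "\<And>x. x \<in> carrier G \<Longrightarrow> (\<integral>\<^sup>+g. u (x \<otimes> g) \<partial>\<mu>) \<le> u x"
  shows "(\<integral>\<^sup>+x. u x \<partial>walk k) \<le> u \<one>"
proof (induction k)
  case 0
  show ?case by simp
next
  case (Suc k)
  have "(\<integral>\<^sup>+x. u x \<partial>walk (Suc k)) = (\<integral>\<^sup>+x. \<integral>\<^sup>+g. u (x \<otimes> g) \<partial>\<mu> \<partial>walk k)"
    unfolding walk_Suc_right by simp
  also have "\<dots> \<le> (\<integral>\<^sup>+x. u x \<partial>walk k)"
    by (rule nn_integral_mono_AE) (use assms set_walk in \<open>auto simp: AE_measure_pmf_iff\<close>)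
  finally show ?case using Suc by simp
qed

text \<open>The function \<open>u\<close> dominates the indicator of \<open>B\<close>, and its
  expectation never exceeds its initial value. The resulting bound does not depend on the time
  \<open>k\<close>.\<close>

lemma emeasure_walk_le:
  fixes u :: "'a \<Rightarrow> ennreal"
  assumes "\<And>x. x \<in> carrier G \<Longrightarrow> (\<integral>\<^sup>+g. u (x \<otimes> g) \<partial>\<mu>) \<le> u x"
    and "\<And>x. x \<in> carrier G \<Longrightarrow> x \<in> B \<Longrightarrow> 1 \<le> u x"
  shows "emeasure (walk k) B \<le> u \<one>"
proof -
  have "emeasure (walk k) B = (\<integral>\<^sup>+x. indicator B x \<partial>walk k)" by simp
  also have "\<dots> \<le> (\<integral>\<^sup>+x. u x \<partial>walk k)"
    by (rule nn_integral_mono_AE)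
       (use assms(2) set_walk in \<open>auto simp: AE_measure_pmf_iff indicator_def\<close>)
  also have "\<dots> \<le> u \<one>" by (rule walk_superharmonic[OF assms(1)])
  finally show ?thesis .
qed

text \<open>Steps on the right commute with translation on the left, so \<open>u\<close> composed
  with left translation by \<open>f\<close> is again superharmonic; its value at the identity is
  \<open>u f\<close>.\<close>

lemma emeasure_walk_translate_le:
  fixes u :: "'a \<Rightarrow> ennreal"
  assumes u: "\<And>x. x \<in> carrier G \<Longrightarrow> (\<integral>\<^sup>+g. u (x \<otimes> g) \<partial>\<mu>) \<le> u x"
    and U: "\<And>x. x \<in> carrier G \<Longrightarrow> x \<in> U \<Longrightarrow> 1 \<le> u x" and f: "f \<in> carrier G"
  shows "emeasure (walk k) {w \<in> carrier G. f \<otimes> w \<in> U} \<le> u f"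
proof -
  have "emeasure (walk k) {w \<in> carrier G. f \<otimes> w \<in> U} \<le> u (f \<otimes> \<one>)"
  proof (rule emeasure_walk_le)
    fix x assume x: "x \<in> carrier G"
    have "(\<integral>\<^sup>+g. u (f \<otimes> (x \<otimes> g)) \<partial>\<mu>) = (\<integral>\<^sup>+g. u (f \<otimes> x \<otimes> g) \<partial>\<mu>)"
      by (rule nn_integral_cong_AE) (use f x in \<open>auto simp: AE_measure_pmf_iff m_assoc mem_supp_carrier\<close>)
    then show "(\<integral>\<^sup>+g. u (f \<otimes> (x \<otimes> g)) \<partial>\<mu>) \<le> u (f \<otimes> x)" using u[of "f \<otimes> x"] f x by simp
  qed (use U f in auto)
  then show ?thesis using f by simp
qed

section \<open>A stationary mean from Cesaro averages of the laws\<close>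

lemma linf_bounded:
  assumes "\<phi> \<in> linf G"
  obtains B where "\<And>x. \<bar>\<phi> x\<bar> \<le> B"
proof -
  from assms obtain B where B: "\<And>x. x \<in> carrier G \<Longrightarrow> \<bar>\<phi> x\<bar> \<le> B" and e: "\<phi> \<in> extensional (carrier G)"
    by (auto simp: in_linf_iff)
  \<comment> \<open>Off the carrier an extensional function takes the value
    \<open>undefined\<close>, which the bound has to cover too.\<close>
  have "\<bar>\<phi> x\<bar> \<le> max B \<bar>undefined\<bar>" for x
    using B[of x] extensional_arb[OF e, of x] by (cases "x \<in> carrier G") auto
  then show thesis by (rule that)
qed

lemma expectation_abs_le:
  fixes f :: "'c \<Rightarrow> real"
  assumes "\<And>x. x \<in> set_pmf p \<Longrightarrow> \<bar>f x\<bar> \<le> B"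
  shows "\<bar>measure_pmf.expectation p f\<bar> \<le> B"
proof -
  have "integrable p f"
    by (rule measure_pmf.integrable_const_bound[where B = B]) (use assms in \<open>auto simp: AE_measure_pmf_iff\<close>)
  moreover have "AE x in p. f x \<le> B" "AE x in p. - B \<le> f x"
    using assms by (auto simp: AE_measure_pmf_iff abs_le_iff) (metis minus_le_iff)
  ultimately show ?thesis
    using measure_pmf.integral_le_const[of p f B] measure_pmf.integral_ge_const[of p f "- B"] by simp
qed

lemma rho_in_linf:
  assumes "\<phi> \<in> linf G"
  shows "rho G \<mu> \<phi> \<in> linf G"
proof -
  obtain B where "\<And>x. \<bar>\<phi> x\<bar> \<le> B" using linf_bounded[OF assms] by blast
  then show ?thesis
    unfolding rho_def by (intro restrict_in_linf[where B = B] expectation_abs_le)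
qed

lemma expectation_walk_rho:
  assumes "\<phi> \<in> linf G"
  shows "measure_pmf.expectation (walk k) (rho G \<mu> \<phi>) = measure_pmf.expectation (walk (Suc k)) \<phi>"
proof -
  obtain B where B: "\<And>x. \<bar>\<phi> x\<bar> \<le> B" using linf_bounded[OF assms] by blast
  have "measure_pmf.expectation (walk (Suc k)) \<phi>
      = measure_pmf.expectation (walk k) (\<lambda>x. measure_pmf.expectation \<mu> (\<lambda>g. \<phi> (inv g \<otimes> x)))"
    unfolding walk.simps by (subst integral_bind_pmf_bounded[OF B]) simp
  also have "\<dots> = measure_pmf.expectation (walk k) (rho G \<mu> \<phi>)"
    by (rule integral_cong_AE) (auto simp: AE_measure_pmf_iff rho_def set_walk)
  finally show ?thesis ..
qed

text \<open>The mean is a cluster point of the Cesaro averages of the laws of the walk, in a compact product of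
  intervals.\<close>

lemma stationary_mean_exists:
  obtains m where "m \<in> stationary_means G \<mu>"
    "\<And>A c. (\<And>k. c \<le> measure_pmf.prob (walk k) A) \<Longrightarrow> c \<le> m (restrict (indicator A) (carrier G))"
proof -
  \<comment> \<open>The value 0 off \<open>linf G\<close> keeps every coordinate bounded, and
    \<open>Suc N\<close> terms keep the denominator nonzero.\<close>
  define avg where "avg = (\<lambda>N \<phi>. if \<phi> \<in> linf G then
    (\<Sum>k<Suc N. measure_pmf.expectation (walk k) \<phi>) / Suc N else 0)"
  have avg: "avg N \<phi> = (\<Sum>k<Suc N. measure_pmf.expectation (walk k) \<phi>) / Suc N" if "\<phi> \<in> linf G" for N \<phi>
    using that by (simp add: avg_def)
  have integ: "integrable (walk k) \<phi>" if \<phi>: "\<phi> \<in> linf G" for k \<phi>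
  proof -
    obtain B where "\<And>x. \<bar>\<phi> x\<bar> \<le> B" using linf_bounded[OF \<phi>] by blast
    then show ?thesis by (intro measure_pmf.integrable_const_bound[where B = B]) auto
  qed
  have avg_le: "\<bar>avg N \<phi>\<bar> \<le> B" if \<phi>: "\<phi> \<in> linf G" and B: "\<And>x. x \<in> carrier G \<Longrightarrow> \<bar>\<phi> x\<bar> \<le> B" for N \<phi> B
  proof -
    have "\<bar>measure_pmf.expectation (walk k) \<phi>\<bar> \<le> B" for k
      by (rule expectation_abs_le) (use B set_walk in blast)
    then have "(\<Sum>k<Suc N. \<bar>measure_pmf.expectation (walk k) \<phi>\<bar>) \<le> card {..<Suc N} * B"
      by (intro sum_bounded_above) auto
    then have "\<bar>\<Sum>k<Suc N. measure_pmf.expectation (walk k) \<phi>\<bar> \<le> Suc N * B"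
      by (intro order.trans[OF sum_abs]) (simp del: sum.lessThan_Suc)
    then show ?thesis by (simp add: avg[OF \<phi>] abs_divide divide_le_eq mult.commute del: sum.lessThan_Suc)
  qed
  have avg_ge: "c \<le> avg N \<phi>" if \<phi>: "\<phi> \<in> linf G" and c: "\<And>k. c \<le> measure_pmf.expectation (walk k) \<phi>" for N \<phi> c
  proof -
    have "card {..<Suc N} * c \<le> (\<Sum>k<Suc N. measure_pmf.expectation (walk k) \<phi>)"
      using c by (intro sum_bounded_below) auto
    then show ?thesis by (simp add: avg[OF \<phi>] le_divide_eq mult.commute del: sum.lessThan_Suc)
  qed

  have "\<forall>\<phi>. \<exists>B. \<phi> \<in> linf G \<longrightarrow> (\<forall>x\<in>carrier G. \<bar>\<phi> x\<bar> \<le> B)"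
    by (auto simp: in_linf_iff)
  then obtain b where b: "\<And>\<phi> x. \<phi> \<in> linf G \<Longrightarrow> x \<in> carrier G \<Longrightarrow> \<bar>\<phi> x\<bar> \<le> b \<phi>" by metis
  \<comment> \<open>All averages lie in the product of these sets, which is compact by Tychonoff's
    theorem.\<close>
  define S where "S = (\<lambda>\<phi>. if \<phi> \<in> linf G then {- b \<phi>..b \<phi>} else {0})"
  have "compact (PiE UNIV S)"
    unfolding compactin_euclidean_iff[symmetric] euclidean_product_topology[symmetric] compactin_PiE
    by (auto simp: S_def compactin_euclidean_iff)
  moreover have "avg N \<in> PiE UNIV S" for N
  proof (rule PiE_I)
    show "avg N \<phi> \<in> S \<phi>" for \<phi>
    proof (cases "\<phi> \<in> linf G")
      case True
      then have "\<bar>avg N \<phi>\<bar> \<le> b \<phi>" by (intro avg_le b)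
      then show ?thesis using True by (auto simp: S_def abs_le_iff)
    qed (simp add: S_def avg_def)
  qed simp
  ultimately obtain l where l: "inf (nhds l) (filtermap avg sequentially) \<noteq> bot"
    unfolding compact_filter
    by (metis (mono_tags, lifting) eventually_filtermap always_eventually filtermap_bot_iff sequentially_bot)
  \<comment> \<open>Along \<open>E\<close> every coordinate tends to that of \<open>l\<close>, and
    whatever holds for all averages holds eventually; \<open>E\<close> does the work of a convergent
    subsequence.\<close>
  define E where "E = inf (nhds l) (filtermap avg sequentially)"
  have E: "E \<noteq> bot" using l by (simp add: E_def)
  have lim: "((\<lambda>f. f \<phi>) \<longlongrightarrow> l \<phi>) E" for \<phi>
  proof -
    have "((\<lambda>f. f) \<longlongrightarrow> l) E"
      by (simp add: filterlim_def E_def)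
    then show ?thesis
      using continuous_on_tendsto_compose[OF continuous_on_product_coordinates[of \<phi>], of "\<lambda>f. f" l E] by simp
  qed
  have ev: "eventually P E" if "\<And>N. P (avg N)" for P
  proof -
    have "eventually P (filtermap avg sequentially)" using that by (simp add: eventually_filtermap)
    then show ?thesis unfolding E_def by (rule filter_leD[OF inf_le2])
  qed
  have l_le: "\<bar>l \<phi>\<bar> \<le> B" if "\<phi> \<in> linf G" "\<And>x. x \<in> carrier G \<Longrightarrow> \<bar>\<phi> x\<bar> \<le> B" for \<phi> B
    by (rule tendsto_upperbound[OF tendsto_rabs[OF lim] ev E]) (rule avg_le[OF that])
  have l_ge: "c \<le> l \<phi>" if "\<phi> \<in> linf G" "\<And>k. c \<le> measure_pmf.expectation (walk k) \<phi>" for \<phi> c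
    by (rule tendsto_lowerbound[OF lim ev E]) (rule avg_ge[OF that])

  have add: "(\<lambda>x\<in>carrier G. \<phi> x + \<psi> x) \<in> linf G \<and> l (\<lambda>x\<in>carrier G. \<phi> x + \<psi> x) = l \<phi> + l \<psi>"
    if \<phi>: "\<phi> \<in> linf G" and \<psi>: "\<psi> \<in> linf G" for \<phi> \<psi>
  proof -
    let ?s = "\<lambda>x\<in>carrier G. \<phi> x + \<psi> x"
    have s: "?s \<in> linf G"
      using b[OF \<phi>] b[OF \<psi>] by (intro restrict_in_linf[where B = "b \<phi> + b \<psi>"]) fastforce
    have "measure_pmf.expectation (walk k) ?s = measure_pmf.expectation (walk k) \<phi> + measure_pmf.expectation (walk k) \<psi>" for k
    proof -
      have "measure_pmf.expectation (walk k) ?s = measure_pmf.expectation (walk k) (\<lambda>x. \<phi> x + \<psi> x)"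
        by (rule integral_cong_AE) (auto simp: AE_measure_pmf_iff set_walk)
      then show ?thesis using integ[OF \<phi>] integ[OF \<psi>] by simp
    qed
    then have "avg N ?s = avg N \<phi> + avg N \<psi>" for N
      by (simp add: avg[OF s] avg[OF \<phi>] avg[OF \<psi>] sum.distrib add_divide_distrib del: sum.lessThan_Suc)
    then have "eventually (\<lambda>f. f ?s = f \<phi> + f \<psi>) E" by (rule ev)
    then have "((\<lambda>f. f ?s) \<longlongrightarrow> l \<phi> + l \<psi>) E"
      using tendsto_cong[of "\<lambda>f. f ?s" "\<lambda>f. f \<phi> + f \<psi>" E] tendsto_add[OF lim lim] by blast
    then show ?thesis using s tendsto_unique[OF E lim] by blast
  qed
  have scale: "(\<lambda>x\<in>carrier G. c * \<phi> x) \<in> linf G \<and> l (\<lambda>x\<in>carrier G. c * \<phi> x) = c * l \<phi>"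
    if \<phi>: "\<phi> \<in> linf G" for c \<phi>
  proof -
    let ?s = "\<lambda>x\<in>carrier G. c * \<phi> x"
    have s: "?s \<in> linf G"
      using b[OF \<phi>] by (intro restrict_in_linf[where B = "\<bar>c\<bar> * b \<phi>"]) (simp add: abs_mult mult_left_mono)
    have "measure_pmf.expectation (walk k) ?s = c * measure_pmf.expectation (walk k) \<phi>" for k
    proof -
      have "measure_pmf.expectation (walk k) ?s = measure_pmf.expectation (walk k) (\<lambda>x. c * \<phi> x)"
        by (rule integral_cong_AE) (auto simp: AE_measure_pmf_iff set_walk)
      then show ?thesis by simp
    qed
    then have "avg N ?s = c * avg N \<phi>" for N
      by (simp add: avg[OF s] avg[OF \<phi>] sum_distrib_left[symmetric] del: sum.lessThan_Suc)
    then have "eventually (\<lambda>f. f ?s = c * f \<phi>) E" by (rule ev)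
    then have "((\<lambda>f. f ?s) \<longlongrightarrow> c * l \<phi>) E"
      using tendsto_cong[of "\<lambda>f. f ?s" "\<lambda>f. c * f \<phi>" E] tendsto_mult[OF tendsto_const lim] by blast
    then show ?thesis using s tendsto_unique[OF E lim] by blast
  qed
  have stat: "l (rho G \<mu> \<phi>) = l \<phi>" if \<phi>: "\<phi> \<in> linf G" for \<phi>
  proof -
    obtain B where B: "\<And>x. \<bar>\<phi> x\<bar> \<le> B" using linf_bounded[OF \<phi>] by blast
    \<comment> \<open>Applying \<open>rho\<close> shifts time by one, so the difference telescopes
      to two terms of size at most \<open>B\<close>.\<close>
    have "\<bar>avg N (rho G \<mu> \<phi>) - avg N \<phi>\<bar> \<le> 2 * B * inverse (real (Suc N))" for N
    proof -
      have "avg N (rho G \<mu> \<phi>) - avg N \<phi>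
          = (\<Sum>k<Suc N. measure_pmf.expectation (walk (Suc k)) \<phi> - measure_pmf.expectation (walk k) \<phi>) / Suc N"
        by (simp add: avg \<phi> rho_in_linf expectation_walk_rho sum_subtractf diff_divide_distrib del: sum.lessThan_Suc walk.simps)
      also have "\<dots> = (measure_pmf.expectation (walk (Suc N)) \<phi> - measure_pmf.expectation (walk 0) \<phi>) / Suc N"
        using sum_lessThan_telescope[of "\<lambda>k. measure_pmf.expectation (walk k) \<phi>" "Suc N"] by (simp only:)
      finally show ?thesis
        using expectation_abs_le[of "walk (Suc N)" \<phi> B, OF B] expectation_abs_le[of "walk 0" \<phi> B, OF B]
        by (simp add: abs_divide divide_inverse[symmetric] divide_right_mono del: walk.simps)
    qed
    then have "eventually (\<lambda>N. norm (avg N (rho G \<mu> \<phi>) - avg N \<phi>) \<le> 2 * B * inverse (real (Suc N))) sequentially"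
      by (intro always_eventually) simp
    moreover have "(\<lambda>N. 2 * B * inverse (real (Suc N))) \<longlonglongrightarrow> 0"
      by (rule tendsto_mult_right_zero[OF LIMSEQ_inverse_real_of_nat])
    ultimately have "(\<lambda>N. avg N (rho G \<mu> \<phi>) - avg N \<phi>) \<longlonglongrightarrow> 0"
      by (rule Lim_null_comparison)
    then have "((\<lambda>f. f (rho G \<mu> \<phi>) - f \<phi>) \<longlongrightarrow> 0) (filtermap avg sequentially)"
      by (simp add: filterlim_filtermap)
    then have "((\<lambda>f. f (rho G \<mu> \<phi>) - f \<phi>) \<longlongrightarrow> 0) E"
      unfolding E_def by (rule tendsto_mono[OF inf_le2])
    moreover have "((\<lambda>f. f (rho G \<mu> \<phi>) - f \<phi>) \<longlongrightarrow> l (rho G \<mu> \<phi>) - l \<phi>) E"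
      by (intro tendsto_diff lim)
    ultimately show ?thesis using tendsto_unique[OF E] by fastforce
  qed

  define m where "m = restrict l (linf G)"
  have m_eq: "m \<phi> = l \<phi>" if "\<phi> \<in> linf G" for \<phi> using that by (simp add: m_def)
  have ind_linf: "restrict (indicator A) (carrier G) \<in> linf G" for A
    by (rule restrict_in_linf[where B = 1]) simp
  have large: "c \<le> m (restrict (indicator A) (carrier G))"
    if c: "\<And>k. c \<le> measure_pmf.prob (walk k) A" for A c
  proof -
    have "measure_pmf.expectation (walk k) (restrict (indicator A) (carrier G)) = measure_pmf.prob (walk k) A" for k
    proof -
      have "measure_pmf.expectation (walk k) (restrict (indicator A) (carrier G))
          = measure_pmf.expectation (walk k) (indicator A :: 'a \<Rightarrow> real)"
        by (rule integral_cong_AE) (auto simp: AE_measure_pmf_iff set_walk)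
      then show ?thesis by simp
    qed
    then show ?thesis using c by (simp add: m_eq ind_linf l_ge)
  qed
  have "functional_norm G m = 1"
    unfolding functional_norm_def
  proof (rule antisym)
    show "(SUP \<phi>\<in>{\<phi> \<in> linf G. linf_norm G \<phi> \<le> 1}. ereal \<bar>m \<phi>\<bar>) \<le> 1"
    proof (rule SUP_least)
      fix \<phi> assume "\<phi> \<in> {\<phi> \<in> linf G. linf_norm G \<phi> \<le> 1}"
      then have \<phi>: "\<phi> \<in> linf G" "linf_norm G \<phi> \<le> 1" by auto
      have "\<bar>\<phi> x\<bar> \<le> 1" if "x \<in> carrier G" for x
      proof -
        have "\<bar>\<phi> x\<bar> \<le> linf_norm G \<phi>"
          unfolding linf_norm_def using b[OF \<phi>(1)] that by (intro cSUP_upper bdd_aboveI2) auto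
        then show ?thesis using \<phi>(2) by simp
      qed
      then show "ereal \<bar>m \<phi>\<bar> \<le> 1" using l_le[OF \<phi>(1)] by (simp add: m_eq \<phi>(1) one_ereal_def)
    qed
    \<comment> \<open>The norm is attained at the constant 1, written as an indicator so that
      \<open>large\<close> applies with \<open>c = 1\<close>.\<close>
    let ?o = "restrict (indicator UNIV) (carrier G) :: 'a \<Rightarrow> real"
    have "linf_norm G ?o \<le> 1"
      unfolding linf_norm_def by (intro cSUP_least) auto
    then have "ereal \<bar>m ?o\<bar> \<le> (SUP \<phi>\<in>{\<phi> \<in> linf G. linf_norm G \<phi> \<le> 1}. ereal \<bar>m \<phi>\<bar>)"
      using ind_linf[of UNIV] by (intro SUP_upper CollectI conjI)
    moreover have "1 \<le> m ?o" by (rule large) simp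
    then have "1 \<le> ereal \<bar>m ?o\<bar>" by (simp add: one_ereal_def)
    ultimately show "1 \<le> (SUP \<phi>\<in>{\<phi> \<in> linf G. linf_norm G \<phi> \<le> 1}. ereal \<bar>m \<phi>\<bar>)"
      by (rule order_trans[rotated])
  qed
  moreover have "linear_functional G m"
    unfolding linear_functional_def using add scale by (simp add: m_eq)
  moreover have "positive_functional G m"
    unfolding positive_functional_def
  proof (intro ballI impI)
    fix \<phi> assume \<phi>: "\<phi> \<in> linf G" and pos: "\<forall>x\<in>carrier G. 0 \<le> \<phi> x"
    have "0 \<le> measure_pmf.expectation (walk k) \<phi>" for k
      by (rule integral_nonneg_AE) (use pos set_walk in \<open>auto simp: AE_measure_pmf_iff\<close>)
    then show "0 \<le> m \<phi>" using l_ge[OF \<phi>] by (simp add: m_eq \<phi>)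
  qed
  ultimately have "m \<in> means G" by (simp add: means_def m_def)
  moreover have "rho_adjoint G \<mu> m = m"
    by (auto simp: rho_adjoint_def fun_eq_iff m_def rho_in_linf stat restrict_def)
  ultimately have "m \<in> stationary_means G \<mu>" by (simp add: stationary_means_def)
  then show thesis using large by (rule that)
qed

text \<open>Uniformity in \<open>k\<close> is essential: a single set \<open>A\<close> avoids all
  exceptional events and still has probability at least 1/2 at every time, a bound that the limiting
  mean retains.\<close>

lemma not_left_syndetic_criterion:
  assumes "\<And>F \<epsilon>. finite F \<Longrightarrow> F \<subseteq> carrier G \<Longrightarrow> 0 < \<epsilon> \<Longrightarrow> \<exists>x\<in>carrier G. \<exists>U.
    \<forall>k. measure_pmf.prob (walk k) {w \<in> carrier G. x \<otimes> w \<notin> U \<or> (\<exists>f\<in>F. f \<otimes> w \<in> U)} \<le> \<epsilon>"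
  shows "\<exists>A\<subseteq>carrier G. stationary_large G \<mu> A \<and> \<not> left_syndetic G (difference_set G A)"
proof -
  \<comment> \<open>Initial segments of an enumeration, so that every finite subset of the group
    lies in some \<open>F n\<close>.\<close>
  define F where "F = (\<lambda>n. from_nat_into (carrier G) ` {..n::nat})"
  have F: "finite (F n)" "F n \<subseteq> carrier G" for n
    using from_nat_into[of "carrier G"] by (auto simp: F_def)
  \<comment> \<open>The tolerances sum to 1/2, leaving half of the mass.\<close>
  have "\<forall>n. \<exists>x U. x \<in> carrier G \<and> (\<forall>k. measure_pmf.prob (walk k)
      {w \<in> carrier G. x \<otimes> w \<notin> U \<or> (\<exists>f\<in>F n. f \<otimes> w \<in> U)} \<le> (1 / 2) ^ (n + 2))"
  proof
    fix n
    have "0 < (1 / 2 :: real) ^ (n + 2)" by simp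
    from assms[OF F this, of n] show "\<exists>x U. x \<in> carrier G \<and> (\<forall>k. measure_pmf.prob (walk k)
      {w \<in> carrier G. x \<otimes> w \<notin> U \<or> (\<exists>f\<in>F n. f \<otimes> w \<in> U)} \<le> (1 / 2) ^ (n + 2))"
      by blast
  qed
  from choice[OF this] obtain x where "\<forall>n. \<exists>U. x n \<in> carrier G \<and> (\<forall>k. measure_pmf.prob (walk k)
      {w \<in> carrier G. x n \<otimes> w \<notin> U \<or> (\<exists>f\<in>F n. f \<otimes> w \<in> U)} \<le> (1 / 2) ^ (n + 2))" ..
  from choice[OF this] obtain U where x: "\<And>n. x n \<in> carrier G" and
    xU: "\<And>n k. measure_pmf.prob (walk k)
      {w \<in> carrier G. x n \<otimes> w \<notin> U n \<or> (\<exists>f\<in>F n. f \<otimes> w \<in> U n)} \<le> (1 / 2) ^ (n + 2)"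
    by blast
  define B where "B = (\<lambda>n. {w \<in> carrier G. x n \<otimes> w \<notin> U n \<or> (\<exists>f\<in>F n. f \<otimes> w \<in> U n)})"
  define A where "A = carrier G - (\<Union>n. B n)"
  have sums: "(\<lambda>n. (1 / 2 :: real) ^ (n + 2)) sums (1 / 2)"
    using sums_mult[OF geometric_sums[of "1 / 2 :: real"], of "1 / 4"] by (simp add: power_add)
  have "1 / 2 \<le> measure_pmf.prob (walk k) A" for k
  proof -
    have smb: "summable (\<lambda>n. measure_pmf.prob (walk k) (B n))"
      by (rule summable_comparison_test'[OF sums_summable[OF sums], of 0]) (use xU in \<open>simp add: B_def\<close>)
    have "measure_pmf.prob (walk k) (\<Union>n. B n) \<le> (\<Sum>n. measure_pmf.prob (walk k) (B n))"
      by (rule measure_pmf.finite_measure_subadditive_countably) (use smb in auto)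
    also have "\<dots> \<le> (\<Sum>n. (1 / 2) ^ (n + 2))"
      by (rule suminf_le) (use xU smb sums_summable[OF sums] in \<open>auto simp: B_def\<close>)
    also have "\<dots> = 1 / 2" using sums_unique[OF sums] by simp
    finally have "measure_pmf.prob (walk k) (\<Union>n. B n) \<le> 1 / 2" .
    moreover have "measure_pmf.prob (walk k) (carrier G) = 1"
      using measure_pmf.prob_eq_1[of "carrier G" "walk k"] set_walk by (simp add: AE_measure_pmf_iff)
    moreover have "measure_pmf.prob (walk k) A = measure_pmf.prob (walk k) (carrier G) - measure_pmf.prob (walk k) (\<Union>n. B n)"
      unfolding A_def by (rule measure_pmf.finite_measure_Diff) (auto simp: B_def)
    ultimately show ?thesis by simp
  qed
  then obtain m where "m \<in> stationary_means G \<mu>" "1 / 2 \<le> m (restrict (indicator A) (carrier G))"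
    using stationary_mean_exists by metis
  then have "stationary_large G \<mu> A"
    unfolding stationary_large_def less_SUP_iff by (intro bexI[of _ m]) auto
  moreover have "\<not> left_syndetic G (difference_set G A)"
  proof
    assume "left_syndetic G (difference_set G A)"
    then obtain K where K: "finite K" "K \<subseteq> carrier G" and eq: "K <#> difference_set G A = carrier G"
      by (auto simp: left_syndetic_def)
    \<comment> \<open>The last index needed to enumerate \<open>K\<close>; the inserted 0 covers an
      empty \<open>K\<close>.\<close>
    define n where "n = Max (insert 0 (to_nat_on (carrier G) ` K))"
    have n: "f \<in> F n" if "f \<in> K" for f
    proof -
      have "f = from_nat_into (carrier G) (to_nat_on (carrier G) f)"
        using that K(2) by (simp add: countable_carrier subset_iff)
      moreover have "to_nat_on (carrier G) f \<le> n"
        unfolding n_def using K(1) that by (intro Max_ge) auto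
      ultimately show ?thesis unfolding F_def by blast
    qed
    have "x n \<in> K <#> difference_set G A" using x eq by simp
    then obtain f a b where f: "f \<in> K" and ab: "a \<in> A" "b \<in> A" and xn: "x n = f \<otimes> (a \<otimes> inv b)"
      by (auto simp: set_mult_def difference_set_def)
    have car: "f \<in> carrier G" "a \<in> carrier G" "b \<in> carrier G" using f ab K(2) by (auto simp: A_def)
    \<comment> \<open>This element lies in \<open>U n\<close> because \<open>b\<close> is not
      exceptional, and outside \<open>U n\<close> because \<open>a\<close> is not and
      \<open>f\<close> is in \<open>F n\<close>.\<close>
    have "x n \<otimes> b = f \<otimes> a" using car by (simp add: xn m_assoc)
    moreover have "b \<notin> B n" "a \<notin> B n" using ab by (auto simp: A_def)
    ultimately show False using car n[OF f] by (auto simp: B_def)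
  qed
  ultimately show ?thesis by (intro exI[of _ A]) (auto simp: A_def)
qed

end

section \<open>The simple random walk on the 3-regular tree\<close>

text \<open>The generators of the three factors of order two; each is its own inverse, so inverses
  get no letters of their own.\<close>

datatype letter = LA | LB | LC

instance letter :: countable
  by countable_datatype

lemma UNIV_letter: "UNIV = {LA, LB, LC}"
  using letter.exhaust by auto

instance letter :: finite
  by standard (simp add: UNIV_letter)

lemma sum_letter: "(\<Sum>s\<in>UNIV. f s) = f LA + f LB + f LC"
  by (simp add: UNIV_letter add.assoc)

text \<open>An element of the free product is stored as its reduced word with the last letter first, so that
  right multiplication by a generator is \<open>push\<close>, acting on the head of the list.\<close>

fun push :: "letter \<Rightarrow> letter list \<Rightarrow> letter list" where
  "push s [] = [s]"
| "push s (t # w) = (if s = t then w else s # t # w)"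

lemma distinct_adj_push: "distinct_adj w \<Longrightarrow> distinct_adj (push s w)"
  by (cases w) (auto dest: distinct_adj_ConsD)

lemma push_push: "distinct_adj w \<Longrightarrow> push s (push s w) = w"
  by (cases w rule: remdups_adj.cases) auto

lemma push_Cons: "distinct_adj (s # w) \<Longrightarrow> push s w = s # w"
  by (cases w) auto

text \<open>\<open>foldr push y x\<close> is the product \<open>xy\<close>: the first letter of
  \<open>y\<close> sits at the end of the list and is pushed first.\<close>

lemma distinct_adj_foldr_push: "distinct_adj x \<Longrightarrow> distinct_adj (foldr push y x)"
  by (induction y) (auto intro: distinct_adj_push)

text \<open>If \<open>s\<close> cancels the head of \<open>y\<close>, then on the right-hand side it
  undoes the last push, \<open>push s\<close> being an involution on reduced words. This is the
  cancellation case of associativity.\<close>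

lemma foldr_push_push: "distinct_adj x \<Longrightarrow> foldr push (push s y) x = push s (foldr push y x)"
  by (cases y) (auto simp: push_push distinct_adj_foldr_push)

lemma foldr_push_assoc:
  "distinct_adj x \<Longrightarrow> foldr push (foldr push z y) x = foldr push z (foldr push y x)"
  by (induction z) (auto simp: foldr_push_push)

lemma foldr_push_Nil: "distinct_adj y \<Longrightarrow> foldr push y [] = y"
proof (induction y)
  case (Cons s y)
  then have "foldr push y [] = y" by (auto dest: distinct_adj_ConsD)
  then show ?case using push_Cons[OF Cons.prems] by simp
qed simp

lemma foldr_push_rev: "foldr push x (rev x) = []"
proof -
  \<comment> \<open>Each letter cancels the current head, so a word folded into itself
    vanishes.\<close>
  have "fold push y y = []" for y by (induction y) auto
  then show ?thesis by (simp add: foldr_conv_fold)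
qed

text \<open>Words are coded by natural numbers because the example is asserted for a group on
  \<open>nat\<close>.\<close>

definition tree_group :: "nat monoid" where
  "tree_group = \<lparr>carrier = to_nat ` {w :: letter list. distinct_adj w},
     monoid.mult = (\<lambda>x y. to_nat (foldr push (from_nat y) (from_nat x))), one = to_nat ([] :: letter list)\<rparr>"

definition tree_measure :: "nat pmf" where
  "tree_measure = map_pmf (\<lambda>s :: letter. to_nat [s]) (pmf_of_set UNIV)"

lemma tree_group_simps:
  "to_nat w \<in> carrier tree_group \<longleftrightarrow> distinct_adj w"
  "to_nat v \<otimes>\<^bsub>tree_group\<^esub> to_nat w = to_nat (foldr push w v)"
  "\<one>\<^bsub>tree_group\<^esub> = to_nat ([] :: letter list)"
  for v w :: "letter list"
  by (auto simp: tree_group_def)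

lemma tree_group_carrierE:
  assumes "x \<in> carrier tree_group"
  obtains w :: "letter list" where "x = to_nat w" "distinct_adj w"
  using assms by (auto simp: tree_group_def)

lemma group_tree_group: "group tree_group"
proof (rule groupI)
  fix x assume "x \<in> carrier tree_group"
  then obtain w :: "letter list" where w: "x = to_nat w" "distinct_adj w" by (rule tree_group_carrierE)
  show "\<one>\<^bsub>tree_group\<^esub> \<otimes>\<^bsub>tree_group\<^esub> x = x"
    using w by (simp add: tree_group_simps foldr_push_Nil)
  show "\<exists>y\<in>carrier tree_group. y \<otimes>\<^bsub>tree_group\<^esub> x = \<one>\<^bsub>tree_group\<^esub>"
    using w by (intro bexI[of _ "to_nat (rev w)"]) (simp_all add: tree_group_simps foldr_push_rev)
qed (auto elim!: tree_group_carrierE simp: tree_group_simps distinct_adj_foldr_push foldr_push_assoc)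

lemma set_pmf_tree_measure: "set_pmf tree_measure = range (\<lambda>s :: letter. to_nat [s])"
  by (simp add: tree_measure_def)

lemma countable_measured_group_tree: "countable_measured_group tree_group tree_measure"
proof -
  interpret group tree_group by (rule group_tree_group)
  have inv: "inv\<^bsub>tree_group\<^esub> (to_nat [s]) = to_nat [s]" for s :: letter
    by (rule inv_equality) (simp_all add: tree_group_simps)
  show ?thesis
  proof
    show "countable (carrier tree_group)" by (rule countableI_type)
    show supp: "set_pmf tree_measure \<subseteq> carrier tree_group"
      by (auto simp: set_pmf_tree_measure tree_group_simps)
    show "pmf tree_measure g = pmf tree_measure (inv\<^bsub>tree_group\<^esub> g)" if g: "g \<in> carrier tree_group" for g
    \<comment> \<open>Generators are involutions, so \<open>g\<close> equals its inverse as soon as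
      one of the two is a generator; otherwise both masses vanish.\<close>
    proof (cases "g \<in> set_pmf tree_measure \<or> inv\<^bsub>tree_group\<^esub> g \<in> set_pmf tree_measure")
      case True
      then obtain s :: letter where "g = to_nat [s] \<or> inv\<^bsub>tree_group\<^esub> g = to_nat [s]"
        by (auto simp: set_pmf_tree_measure)
      then have "inv\<^bsub>tree_group\<^esub> g = g"
        using inv[of s] inv_inv[OF g] by auto
      then show ?thesis by simp
    qed (simp add: set_pmf_iff)
    have "to_nat w \<in> generate tree_group (set_pmf tree_measure)" if "distinct_adj w" for w :: "letter list"
      using that
    proof (induction w)
      case Nil
      show ?case using generate.one[of tree_group] by (simp add: tree_group_simps)
    next
      case (Cons s w)
      then have "to_nat w \<in> generate tree_group (set_pmf tree_measure)" by (auto dest: distinct_adj_ConsD)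
      moreover have "to_nat [s] \<in> generate tree_group (set_pmf tree_measure)"
        by (rule generate.incl) (simp add: set_pmf_tree_measure)
      ultimately have "to_nat w \<otimes>\<^bsub>tree_group\<^esub> to_nat [s] \<in> generate tree_group (set_pmf tree_measure)"
        by (rule generate.eng)
      then show ?case using Cons.prems by (simp add: tree_group_simps push_Cons)
    qed
    then show "generate tree_group (set_pmf tree_measure) = carrier tree_group"
      using generate_in_carrier[OF supp] by (auto elim!: tree_group_carrierE)
  qed
qed

section \<open>Potentials for entering and leaving a cone\<close>

text \<open>\<open>2\<^sup>-\<^sup>d\<close>, where \<open>d\<close> is the distance in the tree to the cone of words that extend \<open>p\<close>.\<close>

fun cone_potential :: "letter list \<Rightarrow> letter list \<Rightarrow> real" where
  "cone_potential p [] = (1 / 2) ^ length p"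
| "cone_potential p (s # y) =
    (if suffix p (s # y) then 1
     else if suffix (s # y) p then 2 * cone_potential p y
     else cone_potential p y / 2)"

lemma cone_potential_nonneg: "0 \<le> cone_potential p x"
  by (induction p x rule: cone_potential.induct) auto

lemma cone_potential_suffix:
  "suffix x p \<Longrightarrow> cone_potential p x = 2 ^ length x * (1 / 2) ^ length p"
proof (induction x)
  case (Cons s y)
  then have "cone_potential p y = 2 ^ length y * (1 / 2) ^ length p" by (auto dest: suffix_ConsD)
  moreover have "p = s # y" if "suffix p (s # y)"
    using Cons.prems that by (rule suffix_order.antisym[symmetric])
  ultimately show ?case using Cons.prems by (auto simp: power_one_over)
qed simp

lemma cone_potential_eq_1: "suffix p x \<Longrightarrow> cone_potential p x = 1"
  by (cases x) auto

text \<open>Each letter at most doubles the value at the root. Where the potential jumps to 1, the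
  word is at least as long as \<open>p\<close>, so the bound is at least 1.\<close>

lemma cone_potential_le: "cone_potential p x \<le> 2 ^ length x * (1 / 2) ^ length p"
proof (induction x)
  case (Cons s y)
  define c :: real where "c = 2 ^ length y * (1 / 2) ^ length p"
  have "0 \<le> c" by (simp add: c_def)
  moreover have "1 \<le> 2 * c" if "suffix p (s # y)"
  proof -
    have "length p \<le> Suc (length y)" using suffix_length_le[OF that] by simp
    then have "(2 :: real) ^ length p \<le> 2 ^ Suc (length y)" by (rule power_increasing) simp
    then show ?thesis by (simp add: c_def power_one_over field_simps)
  qed
  moreover have "2 ^ length (s # y) * (1 / 2 :: real) ^ length p = 2 * c" by (simp add: c_def)
  moreover have "cone_potential p y \<le> c" using Cons by (simp add: c_def)
  ultimately show ?case by auto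
qed simp

lemma cone_potential_le_1: "cone_potential p x \<le> 1"
proof (induction x)
  case Nil
  show ?case by (simp add: power_le_one)
next
  case (Cons s y)
  have "2 ^ length (s # y) * (1 / 2 :: real) ^ length p \<le> 1" if "suffix (s # y) p"
  proof -
    have "(2 :: real) ^ length (s # y) \<le> 2 ^ length p"
      using suffix_length_le[OF that] by (rule power_increasing) simp
    then show ?thesis by (simp add: power_one_over field_simps)
  qed
  then show ?case using Cons cone_potential_suffix[of "s # y" p] by auto
qed

text \<open>Outside the cone at most one neighbour is nearer to it and doubles the value, while the
  others halve it: \<open>2 + 1/2 + 1/2 = 3\<close>. Inside, the value 1 is maximal.\<close>

lemma cone_potential_superharmonic:
  assumes "distinct_adj x"
  shows "(\<Sum>s\<in>UNIV. cone_potential p (push s x)) \<le> 3 * cone_potential p x"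
proof -
  let ?u = "cone_potential p"
  note u0 = cone_potential_nonneg[of p x]
  consider "suffix p x" | "\<not> suffix p x" "suffix x p" | "\<not> suffix p x" "\<not> suffix x p" by blast
  then show ?thesis
  proof cases
    case 1
    have "(\<Sum>s\<in>UNIV. ?u (push s x)) \<le> 1 + 1 + 1"
      unfolding sum_letter by (intro add_mono cone_potential_le_1)
    then show ?thesis using 1 by (simp add: cone_potential_eq_1)
  next
    case 2
    have child: "?u (t # x) = (if suffix (t # x) p then 2 * ?u x else ?u x / 2)" for t
      using 2 cone_potential_suffix[of "t # x" p] cone_potential_suffix[of x p]
      by (auto simp: suffix_Cons)
    have uniq: "s = t" if "suffix (s # x) p" "suffix (t # x) p" for s t
      using that by (auto simp: suffix_def)
    show ?thesis
    proof (cases x)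
      \<comment> \<open>The root has three children and no parent; at most one child lies on the
        path to \<open>p\<close>.\<close>
      case Nil
      then show ?thesis
        using child uniq[of LA LB] uniq[of LA LC] uniq[of LB LC] u0 by (auto simp: sum_letter)
    next
      case (Cons s y)
      have "?u y = ?u x / 2"
        using 2 cone_potential_suffix[of x p] cone_potential_suffix[of y p] Cons by (auto dest: suffix_ConsD)
      moreover have "?u (push t x) = ?u (t # x)" if "t \<noteq> s" for t using that Cons by simp
      ultimately show ?thesis
        using child uniq[of LA LB] uniq[of LA LC] uniq[of LB LC] u0 Cons
        by (cases s) (auto simp: sum_letter simp del: cone_potential.simps)
    qed
  next
    case 3
    then obtain s y where x: "x = s # y" by (cases x) auto
    have parent: "?u y = 2 * ?u x" using 3 x by simp
    have child: "?u (t # x) = ?u x / 2" for t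
      using 3 by (auto simp: suffix_Cons dest: suffix_ConsD)
    show ?thesis
      using x parent child[of LA] child[of LB] child[of LC] by (cases s) (auto simp: sum_letter simp del: cone_potential.simps)
  qed
qed

text \<open>\<open>2\<^sup>-\<^sup>d\<close>, where \<open>d\<close> is the distance to \<open>p\<close> for words in the cone and \<open>0\<close> outside it.\<close>

definition cone_exit_potential :: "letter list \<Rightarrow> letter list \<Rightarrow> real" where
  "cone_exit_potential p x = (if suffix p x then (1 / 2) ^ (length x - length p) else 1)"

text \<open>Strictly inside the cone the parent doubles the value and the two children halve it;
  elsewhere the value is 1, the maximum.\<close>

lemma cone_exit_potential_superharmonic:
  assumes "distinct_adj x"
  shows "(\<Sum>s\<in>UNIV. cone_exit_potential p (push s x)) \<le> 3 * cone_exit_potential p x"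
proof -
  let ?v = "cone_exit_potential p"
  have le1: "?v y \<le> 1" for y by (simp add: cone_exit_potential_def power_le_one)
  show ?thesis
  proof (cases "strict_suffix p x")
    case False
    then have "?v x = 1" by (auto simp: cone_exit_potential_def strict_suffix_def)
    moreover have "(\<Sum>s\<in>UNIV. ?v (push s x)) \<le> 1 + 1 + 1"
      unfolding sum_letter by (intro add_mono le1)
    ultimately show ?thesis by simp
  next
    case True
    then obtain s y where x: "x = s # y" by (cases x) auto
    have py: "suffix p y" "suffix p x" using True x by (auto simp: strict_suffix_def suffix_Cons)
    have parent: "?v y = 2 * ?v x"
      using py x suffix_length_le[OF py(1)] by (simp add: cone_exit_potential_def Suc_diff_le)
    have child: "?v (t # x) = ?v x / 2" for t
      using py suffix_length_le[OF py(2)] by (simp add: cone_exit_potential_def Suc_diff_le suffix_ConsI)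
    show ?thesis
      using x parent child[of LA] child[of LB] child[of LC] by (cases s) (auto simp: sum_letter)
  qed
qed

section \<open>Walk estimates on the tree and the choice of cones\<close>

lemma nn_integral_tree_measure_le:
  assumes u: "\<And>x. 0 \<le> u x" and "distinct_adj x"
    and le: "(\<Sum>s\<in>UNIV. u (push s x)) \<le> 3 * u x"
  shows "(\<integral>\<^sup>+g. ennreal (u (from_nat (to_nat x \<otimes>\<^bsub>tree_group\<^esub> g))) \<partial>tree_measure) \<le> ennreal (u x)"
proof -
  have "(\<integral>\<^sup>+g. ennreal (u (from_nat (to_nat x \<otimes>\<^bsub>tree_group\<^esub> g))) \<partial>tree_measure)
      = (\<Sum>s\<in>UNIV. ennreal (u (push s x))) / 3"
    unfolding tree_measure_def by (simp add: nn_integral_pmf_of_set tree_group_simps UNIV_letter)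
  also have "\<dots> = ennreal ((\<Sum>s\<in>UNIV. u (push s x)) / 3)"
    using u by (simp add: ennreal_numeral[symmetric] divide_ennreal sum_nonneg del: ennreal_numeral)
  also have "\<dots> \<le> ennreal (u x)" using le by (intro ennreal_leI) simp
  finally show ?thesis .
qed

text \<open>Vertices of one geodesic ray from the root: alternation keeps the words reduced, and
  shorter ones are ancestors of longer ones.\<close>

primrec alt_word :: "nat \<Rightarrow> letter list" where
  "alt_word 0 = []"
| "alt_word (Suc n) = (if even n then LA else LB) # alt_word n"

lemma length_alt_word [simp]: "length (alt_word n) = n"
  by (induction n) auto

lemma distinct_adj_alt_word: "distinct_adj (alt_word n)"
proof (induction n)
  case (Suc n)
  then show ?case by (cases n) auto
qed simp

lemma suffix_alt_word: "suffix (alt_word m) (alt_word (m + k))"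
  by (induction k) (auto intro: suffix_ConsI)

lemma tree_measure_walk_le:
  assumes u: "\<And>x. 0 \<le> u x" and super: "\<And>x. distinct_adj x \<Longrightarrow> (\<Sum>s\<in>UNIV. u (push s x)) \<le> 3 * u x"
    and S: "\<And>x. distinct_adj x \<Longrightarrow> x \<in> S \<Longrightarrow> 1 \<le> u x" and f: "f \<in> carrier tree_group"
  shows "measure_pmf.prob (countable_measured_group.walk tree_group tree_measure k)
    {w \<in> carrier tree_group. from_nat (f \<otimes>\<^bsub>tree_group\<^esub> w) \<in> S} \<le> u (from_nat f)"
proof -
  interpret countable_measured_group tree_group tree_measure by (rule countable_measured_group_tree)
  have "emeasure (walk k) {w \<in> carrier tree_group. f \<otimes>\<^bsub>tree_group\<^esub> w \<in> {g. from_nat g \<in> S}}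
      \<le> ennreal (u (from_nat f))"
    by (rule emeasure_walk_translate_le[OF _ _ f])
       (auto elim!: tree_group_carrierE intro!: nn_integral_tree_measure_le u super S
         simp: ennreal_ge_1)
  then show ?thesis
    using u by (simp add: measure_pmf.emeasure_eq_measure)
qed

lemma tree_group_not_left_syndetic:
  "\<exists>A\<subseteq>carrier tree_group. stationary_large tree_group tree_measure A
     \<and> \<not> left_syndetic tree_group (difference_set tree_group A)"
proof -
  interpret countable_measured_group tree_group tree_measure by (rule countable_measured_group_tree)
  show ?thesis
  proof (rule not_left_syndetic_criterion)
    fix F and \<epsilon> :: real
    assume F: "finite F" "F \<subseteq> carrier tree_group" and \<epsilon>: "0 < \<epsilon>"
    \<comment> \<open>The total error will be \<open>C * (1 / 2) ^ m\<close>: the 1 pays for leaving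
      the cone from \<open>x\<close>, the sum for entering it from the elements of
      \<open>F\<close>.\<close>
    define C :: real where "C = 1 + (\<Sum>f\<in>F. 2 ^ length (from_nat f :: letter list))"
    have C: "0 < C" unfolding C_def by (intro add_pos_nonneg sum_nonneg) auto
    obtain m where m: "(1 / 2 :: real) ^ m < \<epsilon> / C"
      using real_arch_pow_inv[of "\<epsilon> / C" "1 / 2"] \<epsilon> C by auto
    \<comment> \<open>The cone starts at depth \<open>m\<close>, and \<open>x\<close> lies at depth
      \<open>2m\<close> on the same ray, hence at distance \<open>m\<close> from the exit.\<close>
    define p where "p = alt_word m"
    define x :: nat where "x = to_nat (alt_word (m + m))"
    define U where "U = {g :: nat. suffix p (from_nat g)}"
    have x: "x \<in> carrier tree_group" by (simp add: x_def tree_group_simps distinct_adj_alt_word)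
    have exit: "measure_pmf.prob (walk k) {w \<in> carrier tree_group. x \<otimes>\<^bsub>tree_group\<^esub> w \<notin> U} \<le> (1 / 2) ^ m" for k
    proof -
      have "measure_pmf.prob (walk k) {w \<in> carrier tree_group. from_nat (x \<otimes>\<^bsub>tree_group\<^esub> w) \<in> {y. \<not> suffix p y}}
          \<le> cone_exit_potential p (from_nat x)"
        by (rule tree_measure_walk_le[OF _ cone_exit_potential_superharmonic _ x])
           (auto simp: cone_exit_potential_def)
      then show ?thesis
        using suffix_alt_word[of m m] by (simp add: U_def x_def p_def cone_exit_potential_def)
    qed
    have enter: "measure_pmf.prob (walk k) {w \<in> carrier tree_group. f \<otimes>\<^bsub>tree_group\<^esub> w \<in> U}
        \<le> 2 ^ length (from_nat f :: letter list) * (1 / 2) ^ m" if "f \<in> F" for f k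
    proof -
      have "measure_pmf.prob (walk k) {w \<in> carrier tree_group. from_nat (f \<otimes>\<^bsub>tree_group\<^esub> w) \<in> {y. suffix p y}}
          \<le> cone_potential p (from_nat f)"
        by (rule tree_measure_walk_le[OF cone_potential_nonneg cone_potential_superharmonic])
           (use F that in \<open>auto simp: cone_potential_eq_1\<close>)
      also have "\<dots> \<le> 2 ^ length (from_nat f :: letter list) * (1 / 2) ^ length p" by (rule cone_potential_le)
      finally show ?thesis by (simp add: U_def p_def)
    qed
    have "measure_pmf.prob (walk k) {w \<in> carrier tree_group. x \<otimes>\<^bsub>tree_group\<^esub> w \<notin> U \<or> (\<exists>f\<in>F. f \<otimes>\<^bsub>tree_group\<^esub> w \<in> U)} \<le> \<epsilon>" for k
    proof -
      have "{w \<in> carrier tree_group. x \<otimes>\<^bsub>tree_group\<^esub> w \<notin> U \<or> (\<exists>f\<in>F. f \<otimes>\<^bsub>tree_group\<^esub> w \<in> U)}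
          = {w \<in> carrier tree_group. x \<otimes>\<^bsub>tree_group\<^esub> w \<notin> U} \<union> (\<Union>f\<in>F. {w \<in> carrier tree_group. f \<otimes>\<^bsub>tree_group\<^esub> w \<in> U})"
        by auto
      then have "measure_pmf.prob (walk k) {w \<in> carrier tree_group. x \<otimes>\<^bsub>tree_group\<^esub> w \<notin> U \<or> (\<exists>f\<in>F. f \<otimes>\<^bsub>tree_group\<^esub> w \<in> U)}
          \<le> measure_pmf.prob (walk k) {w \<in> carrier tree_group. x \<otimes>\<^bsub>tree_group\<^esub> w \<notin> U}
            + measure_pmf.prob (walk k) (\<Union>f\<in>F. {w \<in> carrier tree_group. f \<otimes>\<^bsub>tree_group\<^esub> w \<in> U})"
        by (simp add: measure_Un_le)
      also have "measure_pmf.prob (walk k) (\<Union>f\<in>F. {w \<in> carrier tree_group. f \<otimes>\<^bsub>tree_group\<^esub> w \<in> U})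
          \<le> (\<Sum>f\<in>F. measure_pmf.prob (walk k) {w \<in> carrier tree_group. f \<otimes>\<^bsub>tree_group\<^esub> w \<in> U})"
        using F(1) by (intro measure_UNION_le) auto
      also have "\<dots> \<le> (\<Sum>f\<in>F. 2 ^ length (from_nat f :: letter list) * (1 / 2) ^ m)"
        by (intro sum_mono enter)
      also have "measure_pmf.prob (walk k) {w \<in> carrier tree_group. x \<otimes>\<^bsub>tree_group\<^esub> w \<notin> U} \<le> (1 / 2) ^ m"
        by (rule exit)
      also have "(1 / 2) ^ m + (\<Sum>f\<in>F. 2 ^ length (from_nat f :: letter list) * (1 / 2) ^ m) = C * (1 / 2) ^ m"
        by (simp add: C_def sum_distrib_right distrib_right)
      also have "\<dots> \<le> \<epsilon>" using m C by (simp add: pos_less_divide_eq mult.commute)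
      finally show ?thesis by simp
    qed
    then show "\<exists>x\<in>carrier tree_group. \<exists>U. \<forall>k. measure_pmf.prob (walk k)
        {w \<in> carrier tree_group. x \<otimes>\<^bsub>tree_group\<^esub> w \<notin> U \<or> (\<exists>f\<in>F. f \<otimes>\<^bsub>tree_group\<^esub> w \<in> U)} \<le> \<epsilon>"
      using x by blast
  qed
qed

theorem corollary1p2:
  "(\<forall>(G :: ('a, 'b) monoid_scheme) \<mu> A.
      countable_measured_group G \<mu> \<and> A \<subseteq> carrier G \<and> stationary_large G \<mu> A \<longrightarrow>
      right_piecewise_left_syndetic G (difference_set G A)) \<and>
   (\<exists>(G :: nat monoid) \<mu> A.
      countable_measured_group G \<mu> \<and> A \<subseteq> carrier G \<and> stationary_large G \<mu> A \<and>
      \<not> left_syndetic G (difference_set G A))"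
  using countable_measured_group.stationary_large_difference_set
    countable_measured_group_tree tree_group_not_left_syndetic by blast

end
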